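(* Let $N\ge1$ be an integer, $p>1$, $q>1$, $\alpha>0$. Assume that either $p>2$, or $p<2$ and $\alpha<\frac{p}{2-p}$. For $a\in\mathbb{R}$ let $w(\cdot,a)$ be the solution of $$(|w'|^{p-2}w')'+\frac{N-1}{r}|w'|^{p-2}w'+rw'+\alpha w+|w|^{q-1}w=0\ \text{ in }(0,\infty),\qquad w(0)=a,\quad w'(0)=0,$$ and set $L(a)=\lim_{r\to\infty}r^\alpha w(r,a)$. Then the function $a\mapsto L(a)$ is continuous on the whole of $\mathbb{R}$. Moreover the family of functions $\big(a\mapsto(1+r)^\alpha w(r,a)\big)_{r\ge0}$ is equicontinuous on $\mathbb{R}$.
   Context: For every $a\in\mathbb{R}$ the initial value problem has a unique solution $w(\cdot,a)\in C^1([0,\infty))$ with $|w'|^{p-2}w'\in C^1([0,\infty))$, and the limit $L(a)\in\mathbb{R}$ exists under the stated assumption on $p,\alpha$. *)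

theory Defs
  imports "HOL-Analysis.Analysis"
begin

(* At x = 0 the value is 0 for every p, also for p < 2: this is the continuous
   extension of \<bar>x\<bar>^(p-2) x, valid for p > 1. *)
definition spow :: "real \<Rightarrow> real \<Rightarrow> real" where
  "spow p x = \<bar>x\<bar> powr (p - 2) * x"

(* f is C^1 on [0,\<infinity>) with derivative f'; the derivative at 0 is one-sided,
   and the values of f and f' on the negative axis are irrelevant. *)
definition C1_half_line :: "(real \<Rightarrow> real) \<Rightarrow> (real \<Rightarrow> real) \<Rightarrow> bool" where
  "C1_half_line f f' \<longleftrightarrow>
     (\<forall>r\<ge>0. (f has_real_derivative f' r) (at r within {0..})) \<and> continuous_on {0..} f'"

definition ivp_solution ::
    "nat \<Rightarrow> real \<Rightarrow> real \<Rightarrow> real \<Rightarrow> real \<Rightarrow> (real \<Rightarrow> real) \<Rightarrow> bool" where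
  "ivp_solution N p q \<alpha> a w \<longleftrightarrow>
     (\<exists>w' u'. C1_half_line w w' \<and> C1_half_line (\<lambda>r. spow p (w' r)) u' \<and>
        (\<forall>r>0. u' r + (real N - 1) / r * spow p (w' r) + r * w' r + \<alpha> * w r
                 + \<bar>w r\<bar> powr (q - 1) * w r = 0) \<and>
        w 0 = a \<and> w' 0 = 0)"

(* Pointwise equicontinuity on S: the modulus may depend on the point x,
   but not on the index i. *)
definition equicontinuous_on ::
    "'a::metric_space set \<Rightarrow> 'i set \<Rightarrow> ('i \<Rightarrow> 'a \<Rightarrow> 'b::metric_space) \<Rightarrow> bool" where
  "equicontinuous_on S I F \<longleftrightarrow>
     (\<forall>x\<in>S. \<forall>\<epsilon>>0. \<exists>\<delta>>0. \<forall>y\<in>S. dist y x < \<delta> \<longrightarrow> (\<forall>i\<in>I. dist (F i y) (F i x) < \<epsilon>))"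

end

theory Submission
  imports Defs
begin

text \<open>Write \<open>v = w'\<close> and \<open>u = spow p v\<close>. The energy gives \<open>\<bar>w r\<bar> \<le> \<bar>w 0\<bar>\<close> and bounds \<open>v\<close>.
  If \<open>w = O(r powr - \<gamma>)\<close>, a barrier for \<open>u\<close> shows that \<open>u / r\<close> decays faster than \<open>w\<close>; the
  equation for \<open>r powr \<theta> * (w + u / r)\<close> then improves the exponent \<open>\<gamma>\<close>, up to \<open>\<alpha>\<close>, and finally
  shows that \<open>r powr \<alpha> * w\<close> converges with a rate that is uniform for bounded \<open>w 0\<close>. It remains to
  prove continuous dependence on \<open>w 0\<close> for bounded \<open>r\<close>. For this the equation is integrated to
  \<open>(r ^ (N - 1) * (u + r * w))' = r ^ (N - 1) * g w\<close> with \<open>g\<close> locally Lipschitz.\<close>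

text \<open>Both auxiliary quantities, \<open>w + u / r\<close> at infinity and
  \<open>u + r * w\<close> on bounded intervals, absorb the drift term \<open>r * v\<close>: after
  differentiation \<open>v\<close> survives only inside \<open>u\<close>. If
  \<open>v = O(r powr - (\<gamma> + 1))\<close>, then \<open>u / r\<close> has decay exponent
  \<open>(\<gamma> + 1) * (p - 1) + 1\<close>, which exceeds \<open>\<gamma>\<close> iff
  \<open>\<gamma> * (2 - p) < p\<close>; asking this for all \<open>\<gamma>\<close> up to
  \<open>\<alpha>\<close> is the restriction on \<open>p\<close> and \<open>\<alpha>\<close>. On
  bounded intervals the obstacle is the origin. Extracting \<open>w\<close> from the flux divides by
  \<open>r ^ N\<close>, and the inverse of \<open>spow p\<close> is not Lipschitz at 0 when p > 2.
  So a short initial interval is treated separately: for \<open>w 0 \<noteq> 0\<close> the size of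
  \<open>u\<close> is known there, and for \<open>w 0 = 0\<close> the energy bound suffices. All
  constants depend only on a bound for \<open>w 0\<close>, so a large radius can be fixed beyond
  which the tails of all nearby solutions are small; before it, continuous dependence
  applies.\<close>

section \<open>Comparison principles on an interval\<close>

text \<open>If \<open>d b > 0\<close>, then \<open>d\<close> is positive after the last point
  \<open>s\<close> with \<open>d s \<le> 0\<close>, hence nonincreasing on \<open>{s..b}\<close>, a
  contradiction. Since the derivative is examined only where \<open>d > 0\<close>, that inequality
  is available when its sign is determined.\<close>

lemma upper_barrier:
  fixes d :: "real \<Rightarrow> real"
  assumes "a \<le> b" and cont: "continuous_on {a..b} d" and "d a \<le> 0"
    and der: "\<And>x. a < x \<Longrightarrow> x < b \<Longrightarrow> d x > 0 \<Longrightarrow> \<exists>D\<le>0. (d has_real_derivative D) (at x)"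
  shows "d b \<le> 0"
proof (rule ccontr)
  assume "\<not> d b \<le> 0"
  let ?S = "{a..b} \<inter> d -` {..0}"
  have "closed ?S"
    using cont by (intro continuous_closed_preimage) auto
  then have "compact ?S"
    by (meson bounded_Int bounded_closed_interval compact_eq_bounded_closed)
  moreover have "a \<in> ?S" using assms by auto
  ultimately have "\<exists>s\<in>?S. \<forall>t\<in>?S. t \<le> s"
    by (intro compact_attains_sup) (auto simp del: Int_iff)
  then obtain s where s: "s \<in> ?S" "\<forall>t\<in>?S. t \<le> s"
    by (elim bexE)
  have "s < b"
    using s \<open>\<not> d b \<le> 0\<close> by (cases "s = b") auto
  moreover have "\<exists>y. (d has_real_derivative y) (at x) \<and> y \<le> 0" if "s < x" "x < b" for x
    using der[of x] s(1) bspec[OF s(2), of x] that by force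
  moreover have "continuous_on {s..b} d"
    using s(1) by (intro continuous_on_subset[OF cont]) auto
  ultimately have "d b \<le> d s"
    using DERIV_nonpos_imp_decreasing_open[of s b d] by auto
  then show False using s \<open>\<not> d b \<le> 0\<close> by auto
qed

lemma DERIV_le_imp_diff_le:
  fixes f g :: "real \<Rightarrow> real"
  assumes "a \<le> b" "continuous_on {a..b} f" "continuous_on {a..b} g"
    and "\<And>x. a < x \<Longrightarrow> x < b \<Longrightarrow> (f has_real_derivative f' x) (at x)"
    and "\<And>x. a < x \<Longrightarrow> x < b \<Longrightarrow> (g has_real_derivative g' x) (at x)"
    and "\<And>x. a < x \<Longrightarrow> x < b \<Longrightarrow> f' x \<le> g' x"
  shows "f b - f a \<le> g b - g a"
proof -
  have "f b - g b \<le> f a - g a"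
  proof (rule DERIV_nonpos_imp_decreasing_open[OF \<open>a \<le> b\<close>])
    show "continuous_on {a..b} (\<lambda>x. f x - g x)"
      using assms by (intro continuous_intros)
    show "\<exists>y. ((\<lambda>x. f x - g x) has_real_derivative y) (at x) \<and> y \<le> 0" if "a < x" "x < b" for x
      using assms(4-6)[OF that] by (intro exI[of _ "f' x - g' x"]) (auto intro: DERIV_diff)
  qed
  then show ?thesis by simp
qed

lemma DERIV_abs_le_imp_abs_diff_le:
  fixes f g :: "real \<Rightarrow> real"
  assumes "a \<le> b" "continuous_on {a..b} f" "continuous_on {a..b} g"
    and f: "\<And>x. a < x \<Longrightarrow> x < b \<Longrightarrow> (f has_real_derivative f' x) (at x)"
    and g: "\<And>x. a < x \<Longrightarrow> x < b \<Longrightarrow> (g has_real_derivative g' x) (at x)"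
    and le: "\<And>x. a < x \<Longrightarrow> x < b \<Longrightarrow> \<bar>f' x\<bar> \<le> g' x"
  shows "\<bar>f b - f a\<bar> \<le> g b - g a"
proof -
  have "f b - f a \<le> g b - g a"
    using le by (intro DERIV_le_imp_diff_le[OF assms(1-3) f g]) (auto simp: abs_le_iff)
  moreover have "(- f b) - (- f a) \<le> g b - g a"
    using le assms(1-3)
    by (intro DERIV_le_imp_diff_le[OF _ _ _ DERIV_minus[OF f] g])
      (auto simp: abs_le_iff intro!: continuous_intros)
  ultimately show ?thesis by linarith
qed

section \<open>Calculus of the signed power\<close>

text \<open>At 0 the difference quotient is \<open>\<bar>h\<bar> powr (s - 2)\<close>. With
  \<open>s = q + 1\<close> this makes the nonlinearity locally Lipschitz.\<close>

lemma DERIV_spow: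
  assumes "s > 2"
  shows "(spow s has_real_derivative (s - 1) * \<bar>x\<bar> powr (s - 2)) (at x)"
proof (cases "x = 0")
  case True
  have "((\<lambda>h. \<bar>h\<bar> powr (s - 2)) \<longlongrightarrow> 0) (at (0::real))"
    using assms by (auto intro!: tendsto_eq_intros)
  then show ?thesis
    using True assms unfolding DERIV_def
    by (simp add: spow_def) (erule Lim_transform_eventually, auto simp: eventually_at_filter)
next
  case False
  consider "x > 0" | "x < 0" using False by linarith
  then show ?thesis
  proof cases
    case 1
    then have "((\<lambda>x. x powr (s - 1)) has_real_derivative (s - 1) * x powr (s - 2)) (at x)"
      by (auto intro!: derivative_eq_intros)
    moreover have "\<forall>\<^sub>F t in nhds x. t powr (s - 1) = spow s t"
      using eventually_gt_at_top
      using eventually_nhds_in_open[of "{0<..}" x] 1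
      by (auto elim!: eventually_mono simp: spow_def powr_diff field_simps power2_eq_square)
    ultimately show ?thesis
      using 1 by (subst (asm) DERIV_cong_ev[OF refl _ refl]) auto
  next
    case 2
    then have "((\<lambda>x. - ((-x) powr (s - 1))) has_real_derivative (s - 1) * \<bar>x\<bar> powr (s - 2)) (at x)"
      by (auto intro!: derivative_eq_intros)
    moreover have "\<forall>\<^sub>F t in nhds x. - ((-t) powr (s - 1)) = spow s t"
      using eventually_nhds_in_open[of "{..<0}" x] 2
      by (auto elim!: eventually_mono simp: spow_def powr_diff field_simps power2_eq_square)
    ultimately show ?thesis
      using 2 by (subst (asm) DERIV_cong_ev[OF refl _ refl]) auto
  qed
qed

lemma abs_spow: "p > 1 \<Longrightarrow> \<bar>spow p x\<bar> = \<bar>x\<bar> powr (p - 1)"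
  by (cases "x = 0") (auto simp: spow_def abs_mult powr_diff field_simps power2_eq_square)

lemma spow_minus [simp]: "spow p (- x) = - spow p x"
  by (simp add: spow_def)

lemma spow_0 [simp]: "spow p 0 = 0"
  by (simp add: spow_def)

lemma spow_eq_abs_spow: "0 \<le> x \<Longrightarrow> spow p x = \<bar>spow p x\<bar>"
  by (simp add: spow_def)

lemma spow_pos_iff [simp]: "spow p x > 0 \<longleftrightarrow> x > 0"
  by (auto simp: spow_def zero_less_mult_iff)

lemma spow_neg_iff [simp]: "spow p x < 0 \<longleftrightarrow> x < 0"
  by (auto simp: spow_def mult_less_0_iff)

lemma spow_strict_mono:
  assumes "p > 1" "x < y"
  shows "spow p x < spow p y"
proof -
  consider "x < 0" "0 \<le> y" | "x \<le> 0" "0 < y" | "0 \<le> x" | "y \<le> 0" by linarith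
  then show ?thesis
  proof cases
    case 3
    then have "\<bar>x\<bar> powr (p - 1) < \<bar>y\<bar> powr (p - 1)"
      using assms by (intro powr_less_mono2) auto
    then show ?thesis
      using assms 3 spow_eq_abs_spow[of x p] spow_eq_abs_spow[of y p] by (simp add: abs_spow)
  next
    case 4
    then have "\<bar>y\<bar> powr (p - 1) < \<bar>x\<bar> powr (p - 1)"
      using assms by (intro powr_less_mono2) auto
    then show ?thesis
      using assms 4 spow_eq_abs_spow[of "-x" p] spow_eq_abs_spow[of "-y" p] by (simp add: abs_spow)
  qed (use spow_pos_iff[of p y] spow_neg_iff[of p x] spow_pos_iff[of p x] spow_neg_iff[of p y] in linarith)+
qed

lemma spow_nonneg_iff [simp]: "spow p x \<ge> 0 \<longleftrightarrow> x \<ge> 0"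
  using spow_neg_iff[of p x] by linarith

lemma spow_less_iff: "p > 1 \<Longrightarrow> spow p x < spow p y \<longleftrightarrow> x < y"
  by (metis spow_strict_mono less_asym linorder_neqE_linordered_idom)

text \<open>The conjugate exponent \<open>p / (p - 1)\<close> gives the inverse map because
  \<open>(p - 1) * (p / (p - 1) - 1) = 1\<close>. It recovers \<open>v\<close>, of which
  \<open>sol\<close> records only continuity, from the differentiable \<open>u\<close>.\<close>

lemma spow_spow_conjugate:
  assumes "p > 1"
  shows "spow (p / (p - 1)) (spow p x) = x"
proof (cases "x = 0")
  case False
  have "(p - 1) * (p / (p - 1) - 2) + (p - 2) = 0"
    using assms by (simp add: field_simps)
  then have "\<bar>x\<bar> powr ((p - 1) * (p / (p - 1) - 2)) * \<bar>x\<bar> powr (p - 2) = 1"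
    using False by (simp flip: powr_add)
  then show ?thesis
    using assms by (subst spow_def) (simp add: abs_spow powr_powr, simp add: spow_def mult.assoc[symmetric])
qed simp

lemma continuous_on_abs_powr:
  fixes f :: "'a::topological_space \<Rightarrow> real"
  shows "continuous_on S f \<Longrightarrow> s > 0 \<Longrightarrow> continuous_on S (\<lambda>x. \<bar>f x\<bar> powr s)"
  by (rule continuous_on_powr') (auto intro!: continuous_intros)

lemma continuous_on_spow:
  fixes f :: "'a::topological_space \<Rightarrow> real"
  assumes "continuous_on S f" "p > 1"
  shows "continuous_on S (\<lambda>x. spow p (f x))"
proof -
  \<comment> \<open>For p < 2 the factor \<open>\<bar>y\<bar> powr (p - 2)\<close> is discontinuous
    at 0; in this form only the positive exponent \<open>p - 1\<close> occurs.\<close>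
  have "spow p y = (max 0 y) powr (p - 1) - (max 0 (- y)) powr (p - 1)" for y
    using assms(2) spow_eq_abs_spow[of y p] spow_eq_abs_spow[of "-y" p] abs_spow[of p y] by (auto simp: max_def)
  then show ?thesis
    using assms by (auto intro!: continuous_intros continuous_on_powr')
qed

text \<open>Includes x = 0, so the energy can be differentiated also where \<open>u\<close> or
  \<open>w\<close> vanishes.\<close>

lemma DERIV_abs_powr:
  assumes "s > 1"
  shows "((\<lambda>x. \<bar>x\<bar> powr s) has_real_derivative s * spow s x) (at x)"
proof (cases "x = 0")
  case True
  have "((\<lambda>h. spow s h) \<longlongrightarrow> 0) (at (0::real))"
    using continuous_on_spow[of UNIV "\<lambda>x. x" s] assms
    by (auto simp: continuous_on_def dest!: spec[of _ 0])
  then show ?thesis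
    using True assms unfolding DERIV_def
    by (simp add: spow_def)
      (erule Lim_transform_eventually, auto simp: eventually_at_filter powr_diff power2_eq_square field_simps abs_if)
next
  case False
  consider "x > 0" | "x < 0" using False by linarith
  then show ?thesis
  proof cases
    case 1
    then have "((\<lambda>x. x powr s) has_real_derivative s * spow s x) (at x)"
      by (auto intro!: derivative_eq_intros simp: spow_def powr_diff field_simps power2_eq_square)
    moreover have "\<forall>\<^sub>F t in nhds x. t powr s = \<bar>t\<bar> powr s"
      using eventually_nhds_in_open[of "{0<..}" x] 1 by (auto elim!: eventually_mono)
    ultimately show ?thesis
      by (subst (asm) DERIV_cong_ev[OF refl _ refl])
  next
    case 2
    then have "((\<lambda>x. (-x) powr s) has_real_derivative s * spow s x) (at x)"
      by (auto intro!: derivative_eq_intros simp: spow_def powr_diff field_simps power2_eq_square)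
    moreover have "\<forall>\<^sub>F t in nhds x. (-t) powr s = \<bar>t\<bar> powr s"
      using eventually_nhds_in_open[of "{..<0}" x] 2 by (auto elim!: eventually_mono)
    ultimately show ?thesis
      by (subst (asm) DERIV_cong_ev[OF refl _ refl])
  qed
qed

section \<open>Solutions and energy bounds\<close>

text \<open>\<open>subcritical\<close> merges the two cases of the theorem: for p > 2 its left side
  is negative, for p < 2 it reads \<open>\<alpha> < p / (2 - p)\<close>.\<close>

locale self_similar =
  fixes n :: nat and p q \<alpha> :: real
  assumes p_gt_1: "p > 1" and q_gt_1: "q > 1" and alpha_pos: "\<alpha> > 0"
    and subcritical: "\<alpha> * (2 - p) < p"
begin

(* v is the derivative of w; the dimension N is n + 1. *)
definition sol :: "(real \<Rightarrow> real) \<Rightarrow> (real \<Rightarrow> real) \<Rightarrow> bool" where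
  "sol w v \<longleftrightarrow> continuous_on {0..} w \<and> continuous_on {0..} v \<and> v 0 = 0 \<and>
     (\<forall>r>0. (w has_real_derivative v r) (at r) \<and>
       ((\<lambda>r. spow p (v r)) has_real_derivative
          - (n / r * spow p (v r)) - r * v r - \<alpha> * w r - spow (q + 1) (w r)) (at r))"

text \<open>The equation is odd, so one-sided estimates become two-sided when applied to
  \<open>- w\<close>.\<close>

lemma sol_minus: "sol w v \<Longrightarrow> sol (\<lambda>r. - w r) (\<lambda>r. - v r)"
  unfolding sol_def by (auto intro!: continuous_intros derivative_eq_intros)

lemma sol_contD:
  assumes "sol w v" "S \<subseteq> {0..}"
  shows "continuous_on S w" "continuous_on S v" "continuous_on S (\<lambda>r. spow p (v r))"
  using assms p_gt_1 continuous_on_subset[OF _ assms(2)]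
  by (auto simp: sol_def intro!: continuous_on_spow)

lemma sol_DERIV:
  assumes "sol w v" "r > 0"
  shows "(w has_real_derivative v r) (at r)"
    "((\<lambda>r. spow p (v r)) has_real_derivative
          - (n / r * spow p (v r)) - r * v r - \<alpha> * w r - spow (q + 1) (w r)) (at r)"
  using assms by (auto simp: sol_def)

lemma sol_0: "sol w v \<Longrightarrow> v 0 = 0"
  by (simp add: sol_def)

text \<open>The first term is the kinetic energy \<open>(p - 1) / p * \<bar>v\<bar> powr p\<close>,
  written through \<open>u\<close> because the equation supplies a derivative of \<open>u\<close>,
  not of \<open>v\<close>.\<close>

definition energy :: "(real \<Rightarrow> real) \<Rightarrow> (real \<Rightarrow> real) \<Rightarrow> real \<Rightarrow> real" where
  "energy w v r = (p - 1) / p * \<bar>spow p (v r)\<bar> powr (p / (p - 1))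
     + \<alpha> / 2 * (w r)\<^sup>2 + \<bar>w r\<bar> powr (q + 1) / (q + 1)"

text \<open>Multiplying the equation by \<open>v\<close> shows that the energy has derivative
  \<open>- (n / x) * u * v - x * v\<^sup>2\<close>; both terms dissipate, as \<open>u\<close> and
  \<open>v\<close> have the same sign.\<close>

lemma energy_le:
  assumes sol: "sol w v" and "r \<ge> 0"
  shows "energy w v r \<le> energy w v 0"
proof (rule DERIV_nonpos_imp_decreasing_open[OF \<open>r \<ge> 0\<close>])
  have p: "p / (p - 1) > 1" using p_gt_1 by simp
  show "continuous_on {0..r} (energy w v)"
    unfolding energy_def using p q_gt_1
    by (intro continuous_intros continuous_on_abs_powr sol_contD[OF sol]) auto
  fix x :: real assume "0 < x"
  let ?u = "\<lambda>r. spow p (v r)"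
  let ?D = "- (n / x * ?u x) - x * v x - \<alpha> * w x - spow (q + 1) (w x)"
  \<comment> \<open>The chain rule produces \<open>spow (p / (p - 1))\<close> of \<open>u\<close>,
    which is \<open>v\<close>.\<close>
  have 1: "((\<lambda>r. \<bar>?u r\<bar> powr (p / (p - 1))) has_real_derivative
      p / (p - 1) * v x * ?D) (at x)"
    using DERIV_chain2[OF DERIV_abs_powr[OF p] sol_DERIV(2)[OF sol \<open>0 < x\<close>]] p_gt_1
    by (simp add: spow_spow_conjugate)
  have 2: "((\<lambda>r. \<bar>w r\<bar> powr (q + 1)) has_real_derivative
      (q + 1) * spow (q + 1) (w x) * v x) (at x)"
    using DERIV_chain2[OF DERIV_abs_powr sol_DERIV(1)[OF sol \<open>0 < x\<close>], of "q + 1"] q_gt_1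
    by simp
  have 3: "((\<lambda>r. (w r)\<^sup>2) has_real_derivative 2 * w x * v x) (at x)"
    by (auto intro!: derivative_eq_intros sol_DERIV[OF sol \<open>0 < x\<close>])
  have "(energy w v has_real_derivative
      (p - 1) / p * (p / (p - 1) * v x * ?D) + \<alpha> / 2 * (2 * w x * v x)
      + ((q + 1) * spow (q + 1) (w x) * v x) / (q + 1)) (at x)"
    unfolding energy_def[abs_def]
    by (intro DERIV_add DERIV_cmult DERIV_cdivide 1 2 3)
  moreover have "(p - 1) / p * (p / (p - 1) * v x * ?D) + \<alpha> / 2 * (2 * w x * v x)
      + ((q + 1) * spow (q + 1) (w x) * v x) / (q + 1) = - (n / x) * (?u x * v x) - x * (v x)\<^sup>2"
  proof -
    have "(p - 1) / p * (p / (p - 1) * v x * ?D) = v x * ?D"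
      and "((q + 1) * spow (q + 1) (w x) * v x) / (q + 1) = spow (q + 1) (w x) * v x"
      using p_gt_1 q_gt_1 by simp_all
    then show ?thesis by (simp add: algebra_simps power2_eq_square)
  qed
  ultimately have "(energy w v has_real_derivative - (n / x) * (?u x * v x) - x * (v x)\<^sup>2) (at x)"
    by simp
  moreover have "?u x * v x \<ge> 0"
    by (simp add: spow_def mult.assoc)
  then have "n / x * (?u x * v x) \<ge> 0" "x * (v x)\<^sup>2 \<ge> 0"
    using \<open>0 < x\<close> by simp_all
  then have "- (n / x) * (?u x * v x) - x * (v x)\<^sup>2 \<le> 0"
    unfolding minus_mult_left[symmetric] by linarith
  ultimately show "\<exists>y. (energy w v has_real_derivative y) (at x) \<and> y \<le> 0"
    by blast
qed

lemma energy_0: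
  "sol w v \<Longrightarrow> energy w v 0 = \<alpha> / 2 * (w 0)\<^sup>2 + \<bar>w 0\<bar> powr (q + 1) / (q + 1)"
  using p_gt_1 by (simp add: energy_def sol_0)

text \<open>The energy at 0 is purely potential because \<open>v 0 = 0\<close>, and the potential
  part increases strictly with \<open>\<bar>w\<bar>\<close>.\<close>

lemma sol_bound:
  assumes "sol w v" "r \<ge> 0"
  shows "\<bar>w r\<bar> \<le> \<bar>w 0\<bar>"
proof (rule ccontr)
  assume "\<not> \<bar>w r\<bar> \<le> \<bar>w 0\<bar>"
  then have "\<bar>w 0\<bar>\<^sup>2 < \<bar>w r\<bar>\<^sup>2" "\<bar>w 0\<bar> powr (q + 1) < \<bar>w r\<bar> powr (q + 1)"
    using q_gt_1 by (intro power_strict_mono powr_less_mono2; simp)+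
  then have "\<alpha> / 2 * (w 0)\<^sup>2 + \<bar>w 0\<bar> powr (q + 1) / (q + 1)
      < \<alpha> / 2 * (w r)\<^sup>2 + \<bar>w r\<bar> powr (q + 1) / (q + 1)"
    using alpha_pos q_gt_1 by (intro add_strict_mono mult_strict_left_mono divide_strict_right_mono) auto
  also have "\<dots> \<le> energy w v r"
    using p_gt_1 by (simp add: energy_def)
  finally show False
    using energy_le[OF assms] energy_0[OF assms(1)] by simp
qed

text \<open>\<open>M\<close> is obtained before any solution, so it depends on \<open>A\<close>
  only; the later estimates keep this quantifier order.\<close>

lemma deriv_bound:
  obtains M where "M \<ge> 1"
    "\<And>w v r. sol w v \<Longrightarrow> \<bar>w 0\<bar> \<le> A \<Longrightarrow> r \<ge> 0 \<Longrightarrow> \<bar>v r\<bar> \<le> M"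
proof -
  define E where "E = \<alpha> / 2 * A\<^sup>2 + A powr (q + 1) / (q + 1)"
  define M where "M = max 1 ((p / (p - 1) * E) powr (1 / p))"
  have "\<bar>v r\<bar> \<le> M" if "sol w v" "\<bar>w 0\<bar> \<le> A" "r \<ge> 0" for w v r
  proof -
    have "(w 0)\<^sup>2 \<le> A\<^sup>2" "\<bar>w 0\<bar> powr (q + 1) \<le> A powr (q + 1)"
      using that q_gt_1 by (auto intro!: powr_mono2 simp: abs_le_square_iff[symmetric])
    then have "energy w v 0 \<le> E"
      unfolding energy_0[OF that(1)] E_def using alpha_pos q_gt_1
      by (intro add_mono mult_left_mono divide_right_mono) auto
    moreover have "(p - 1) / p * \<bar>v r\<bar> powr p \<le> energy w v r"
      using p_gt_1 alpha_pos q_gt_1 by (simp add: energy_def abs_spow powr_powr)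
    ultimately have "(p - 1) / p * \<bar>v r\<bar> powr p \<le> E"
      using energy_le[OF that(1,3)] by linarith
    then have "\<bar>v r\<bar> powr p \<le> p / (p - 1) * E"
      using p_gt_1 by (simp add: field_simps)
    then have "(\<bar>v r\<bar> powr p) powr (1 / p) \<le> (p / (p - 1) * E) powr (1 / p)"
      using p_gt_1 by (intro powr_mono2) auto
    then show ?thesis
      using p_gt_1 by (simp add: M_def powr_powr)
  qed
  then show ?thesis by (intro that[of M]) (auto simp: M_def)
qed

section \<open>Decay at infinity, uniform for bounded initial values\<close>

(* Half of the least value, over exponents \<gamma> in [0, \<alpha>], by which the decay of u / r beats that of w. *)
definition gap :: real where
  "gap = (p - \<alpha> * max (2 - p) 0) / 2"

lemma gap_pos: "gap > 0"
  using p_gt_1 subcritical by (auto simp: gap_def max_def)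

text \<open>The right side is the decay exponent of \<open>u / r\<close> when \<open>v\<close>
  decays like \<open>r powr - (\<gamma> + 1)\<close>. The claim reduces to
  \<open>\<gamma> * (2 - p) \<le> \<alpha> * max (2 - p) 0\<close>.\<close>

lemma gap_le:
  assumes "0 \<le> \<gamma>" "\<gamma> \<le> \<alpha>"
  shows "\<gamma> + 2 * gap \<le> (\<gamma> + 1) * (p - 1) + 1"
proof -
  have "\<gamma> * (2 - p) \<le> \<gamma> * max (2 - p) 0"
    using assms by (intro mult_left_mono) auto
  also have "\<dots> \<le> \<alpha> * max (2 - p) 0"
    using assms by (intro mult_right_mono) auto
  finally have "\<gamma> * (2 - p) \<le> \<alpha> * max (2 - p) 0" .
  moreover have "2 * gap = p - \<alpha> * max (2 - p) 0" by (simp add: gap_def)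
  ultimately show ?thesis by (simp add: algebra_simps)
qed

lemma abs_spow_q_le:
  assumes "\<bar>x\<bar> \<le> A"
  shows "\<bar>spow (q + 1) x\<bar> \<le> A powr (q - 1) * \<bar>x\<bar>"
proof -
  have "\<bar>spow (q + 1) x\<bar> = \<bar>x\<bar> powr (q - 1) * \<bar>x\<bar>"
    by (simp add: spow_def abs_mult)
  also have "\<dots> \<le> A powr (q - 1) * \<bar>x\<bar>"
    using assms q_gt_1 by (intro mult_right_mono powr_mono2) auto
  finally show ?thesis .
qed

definition decay :: "real \<Rightarrow> real \<Rightarrow> bool" where
  "decay A \<gamma> \<longleftrightarrow> (\<exists>C\<ge>0. \<forall>w v r. sol w v \<longrightarrow> \<bar>w 0\<bar> \<le> A \<longrightarrow> 1 \<le> r \<longrightarrow> \<bar>w r\<bar> \<le> C * r powr - \<gamma>)"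

text \<open>The barrier for \<open>v\<close> is \<open>B * x powr - (\<gamma> + 1)\<close>. Above
  it, \<open>x * v\<close> exceeds \<open>B * x powr - \<gamma>\<close>, twice the bound for the
  terms in \<open>w\<close>, so \<open>u\<close> falls at least at rate
  \<open>B / 2 * x powr - \<gamma>\<close>. For large \<open>x\<close> the barrier for
  \<open>u\<close> falls more slowly.\<close>

lemma slope_decay:
  assumes "decay A \<gamma>" and \<gamma>: "0 \<le> \<gamma>" "\<gamma> \<le> \<alpha>"
  obtains B where "B \<ge> 0"
    "\<And>w v r. sol w v \<Longrightarrow> \<bar>w 0\<bar> \<le> A \<Longrightarrow> 1 \<le> r \<Longrightarrow> \<bar>spow p (v r)\<bar> / r \<le> B * r powr - (\<gamma> + 2 * gap)"
proof -
  obtain C where C: "C \<ge> 0"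
    "\<And>w v r. sol w v \<Longrightarrow> \<bar>w 0\<bar> \<le> A \<Longrightarrow> 1 \<le> r \<Longrightarrow> \<bar>w r\<bar> \<le> C * r powr - \<gamma>"
    using assms(1) unfolding decay_def by blast
  obtain M where M: "M \<ge> 1"
    "\<And>w v r. sol w v \<Longrightarrow> \<bar>w 0\<bar> \<le> A \<Longrightarrow> r \<ge> 0 \<Longrightarrow> \<bar>v r\<bar> \<le> M"
    using deriv_bound[of A] by blast
  define F where "F = (\<alpha> + A powr (q - 1)) * C"
  define K where "K = max M (2 * F)"
  define c where "c = (\<gamma> + 1) * (p - 1)"
  \<comment> \<open>The barrier argument needs
    \<open>2 * c * B powr (p - 2) \<le> r0 powr e\<close>, although \<open>B\<close> itself involves
    \<open>r0\<close>. Inserting \<open>B = K * r0 powr (\<gamma> + 1)\<close> leaves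
    \<open>2 * c * K powr (p - 2) \<le> r0 powr 2\<close>, which this choice guarantees.\<close>
  define r0 where "r0 = 1 + K powr (p - 2) * (2 * c)"
  \<comment> \<open>This makes the barrier at least \<open>K \<ge> M\<close> for
    \<open>x \<le> r0\<close>, so it can be crossed only beyond \<open>r0\<close>.\<close>
  define B where "B = K * r0 powr (\<gamma> + 1)"
  define e where "e = p + \<gamma> * (p - 2)"
  have "c > 0" using p_gt_1 \<gamma> by (simp add: c_def)
  then have r0: "r0 \<ge> 1" by (simp add: r0_def)
  have K: "K \<ge> 1" "M \<le> K" "F \<le> K / 2" using M(1) by (auto simp: K_def)
  have "K * 1 \<le> B" unfolding B_def using r0 \<gamma> K
    by (intro mult_left_mono ge_one_powr_ge_zero) auto
  then have B: "B > 0" "F \<le> B / 2" using K by auto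
  have "e > 0" using gap_le[OF \<gamma>] gap_pos by (simp add: e_def algebra_simps)
  have c_e: "c + 1 - \<gamma> = e" by (simp add: c_def e_def algebra_simps)
  have beta_spow: "B powr (p - 1) * x powr - c = spow p (B * x powr - (\<gamma> + 1))" if "x > 0" for x
  proof -
    have "spow p (B * x powr - (\<gamma> + 1)) = (B * x powr - (\<gamma> + 1)) powr (p - 1)"
      using B that spow_eq_abs_spow[of "B * x powr - (\<gamma> + 1)" p] abs_spow[OF p_gt_1, of "B * x powr - (\<gamma> + 1)"]
      by simp
    also have "\<dots> = B powr (p - 1) * x powr - c"
      using B that by (simp add: powr_mult powr_powr c_def algebra_simps)
    finally show ?thesis by simp
  qed
  have small: "\<bar>spow p (v x)\<bar> \<le> B powr (p - 1) * x powr - c"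
    if "sol w v" "\<bar>w 0\<bar> \<le> A" "1 \<le> x" "x \<le> r0" for w v x
  proof -
    have "\<bar>spow p (v x)\<bar> = \<bar>v x\<bar> powr (p - 1)" using p_gt_1 by (simp add: abs_spow)
    also have "\<dots> \<le> K powr (p - 1) * 1"
      using M(2)[OF that(1,2), of x] that p_gt_1 K by (auto intro!: powr_mono2)
    also have "\<dots> \<le> K powr (p - 1) * (r0 powr c * x powr - c)"
      using that \<open>c > 0\<close> powr_mono2[of c x r0]
      by (intro mult_left_mono) (auto simp: powr_minus field_simps)
    also have "\<dots> = B powr (p - 1) * x powr - c"
      using K r0 by (simp add: B_def powr_mult powr_powr c_def)
    finally show ?thesis .
  qed
  have large: "spow p (v r) \<le> B powr (p - 1) * r powr - c"
    if sol: "sol w v" and wA: "\<bar>w 0\<bar> \<le> A" and "r0 \<le> r" for w v r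
  proof -
    define d where "d x = spow p (v x) - B powr (p - 1) * x powr - c" for x
    have "d r \<le> 0"
    proof (rule upper_barrier[OF \<open>r0 \<le> r\<close>])
      show "continuous_on {r0..r} d"
        unfolding d_def using r0 by (auto intro!: continuous_intros sol_contD[OF sol])
      show "d r0 \<le> 0"
        using small[OF sol wA r0 order.refl] by (simp add: d_def)
      fix x assume x: "r0 < x" "d x > 0"
      then have "x > 1" using r0 by simp
      let ?D = "- (n / x * spow p (v x)) - x * v x - \<alpha> * w x - spow (q + 1) (w x)
          - B powr (p - 1) * (- c * x powr (- c - 1))"
      have "(d has_real_derivative ?D) (at x)"
        unfolding d_def using \<open>x > 1\<close>
        by (intro DERIV_diff DERIV_cmult has_real_derivative_powr sol_DERIV[OF sol]) auto
      moreover have "?D \<le> 0"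
      proof -
        have "spow p (B * x powr - (\<gamma> + 1)) < spow p (v x)"
          using x beta_spow[of x] \<open>x > 1\<close> by (simp add: d_def)
        then have v: "B * x powr - (\<gamma> + 1) < v x"
          using spow_less_iff p_gt_1 by blast
        moreover have "0 < B * x powr - (\<gamma> + 1)" using B \<open>x > 1\<close> by simp
        ultimately have "spow p (v x) > 0" by simp
        then have 1: "n / x * spow p (v x) \<ge> 0" using \<open>x > 1\<close> by simp
        have "x * (B * x powr - (\<gamma> + 1)) \<le> x * v x"
          using v \<open>x > 1\<close> by simp
        moreover have "x * (B * x powr - (\<gamma> + 1)) = B * x powr - \<gamma>"
          using \<open>x > 1\<close> by (simp add: powr_diff powr_minus field_simps)
        ultimately have 2: "B * x powr - \<gamma> \<le> x * v x" by linarith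
        have "\<bar>\<alpha> * w x + spow (q + 1) (w x)\<bar> \<le> \<alpha> * \<bar>w x\<bar> + A powr (q - 1) * \<bar>w x\<bar>"
          using abs_spow_q_le[of "w x" A] sol_bound[OF sol, of x] wA \<open>x > 1\<close> alpha_pos
          by (intro order.trans[OF abs_triangle_ineq] add_mono) (auto simp: abs_mult)
        also have "\<dots> = (\<alpha> + A powr (q - 1)) * \<bar>w x\<bar>" by (simp add: algebra_simps)
        also have "\<dots> \<le> (\<alpha> + A powr (q - 1)) * (C * x powr - \<gamma>)"
          using C(2)[OF sol wA, of x] \<open>x > 1\<close> alpha_pos by (intro mult_left_mono) auto
        also have "\<dots> = F * x powr - \<gamma>" by (simp add: F_def)
        also have "\<dots> \<le> B / 2 * x powr - \<gamma>"
          using B by (intro mult_right_mono) auto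
        finally have 3: "\<bar>\<alpha> * w x + spow (q + 1) (w x)\<bar> \<le> B / 2 * x powr - \<gamma>" .
        \<comment> \<open>Equivalent to \<open>c * B powr (p - 1) * x powr (- c - 1) \<le> B / 2 * x
          powr - \<gamma>\<close>: the barrier falls no faster than \<open>u\<close>.\<close>
        have "2 * c * B powr (p - 2) \<le> x powr e"
        proof -
          have "2 * c * B powr (p - 2) = (K powr (p - 2) * (2 * c)) * r0 powr (e - 2)"
            using K r0 by (simp add: B_def powr_mult powr_powr e_def algebra_simps)
          also have "\<dots> \<le> r0 powr 2 * r0 powr (e - 2)"
            using r0 mult_mono[of 1 r0 r0 r0]
            by (intro mult_right_mono) (auto simp: power2_eq_square r0_def)
          also have "\<dots> = r0 powr e" by (simp flip: powr_add)
          also have "\<dots> \<le> x powr e" using \<open>e > 0\<close> x r0 by (intro powr_mono2) auto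
          finally show ?thesis .
        qed
        then have "(B * x powr (- c - 1) / 2) * (2 * c * B powr (p - 2))
            \<le> (B * x powr (- c - 1) / 2) * x powr e"
          using B by (intro mult_left_mono) auto
        also have "\<dots> = B / 2 * (x powr (- c - 1) * x powr e)"
          by simp
        also have "x powr (- c - 1) * x powr e = x powr - \<gamma>"
          by (simp flip: powr_add c_e)
        also have "(B * x powr (- c - 1) / 2) * (2 * c * B powr (p - 2))
            = c * (B * B powr (p - 2)) * x powr (- c - 1)"
          by simp
        also have "B * B powr (p - 2) = B powr (p - 1)"
          using B powr_add[of B 1 "p - 2"] by simp
        finally have 4: "c * B powr (p - 1) * x powr (- c - 1) \<le> B / 2 * x powr - \<gamma>" .
        have 5: "B powr (p - 1) * (- c * x powr (- c - 1)) = - (c * B powr (p - 1) * x powr (- c - 1))"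
          by simp
        show ?thesis
          unfolding 5 using 1 2 3 4 abs_ge_minus_self[of "\<alpha> * w x + spow (q + 1) (w x)"] by linarith
      qed
      ultimately show "\<exists>D\<le>0. (d has_real_derivative D) (at x)" by blast
    qed
    then show ?thesis by (simp add: d_def)
  qed
  have "\<bar>spow p (v r)\<bar> / r \<le> B powr (p - 1) * r powr - (\<gamma> + 2 * gap)"
    if sol: "sol w v" and wA: "\<bar>w 0\<bar> \<le> A" and "1 \<le> r" for w v r
  proof -
    have "\<bar>spow p (v r)\<bar> \<le> B powr (p - 1) * r powr - c"
      using small[OF sol wA \<open>1 \<le> r\<close>] large[OF sol wA] large[OF sol_minus[OF sol]] wA
      by (cases "r \<le> r0") (auto simp: abs_le_iff)
    then have "\<bar>spow p (v r)\<bar> / r \<le> B powr (p - 1) * r powr - c / r"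
      using \<open>1 \<le> r\<close> by (intro divide_right_mono) auto
    also have "\<dots> = B powr (p - 1) * r powr - (c + 1)"
      using \<open>1 \<le> r\<close> by (simp add: powr_diff powr_minus field_simps)
    also have "\<dots> \<le> B powr (p - 1) * r powr - (\<gamma> + 2 * gap)"
      using gap_le[OF \<gamma>] \<open>1 \<le> r\<close> by (intro mult_left_mono powr_mono) (auto simp: c_def)
    finally show ?thesis .
  qed
  then show ?thesis by (intro that[of "B powr (p - 1)"]) auto
qed

text \<open>In \<open>(w + u / r)'\<close> the term \<open>v\<close> cancels against
  \<open>- r * v / r\<close> from the equation. The weight \<open>r powr \<theta>\<close> then
  splits \<open>\<alpha> * w\<close> into a damping term, nonpositive times the sum if
  \<open>\<theta> \<le> \<alpha>\<close>, and a multiple of \<open>u / r\<close>.\<close>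

lemma DERIV_rescaled:
  assumes sol: "sol w v" and "x > 0"
  shows "((\<lambda>r. r powr \<theta> * (w r + spow p (v r) / r)) has_real_derivative
    x powr (\<theta> - 1) * ((\<theta> - \<alpha>) * (w x + spow p (v x) / x)
       + (\<alpha> - (n + 1)) * (spow p (v x) / x) - spow (q + 1) (w x))) (at x)"
proof -
  have "((\<lambda>r. r powr \<theta> * (w r + spow p (v r) / r)) has_real_derivative
     (\<theta> * x powr (\<theta> - 1)) * (w x + spow p (v x) / x) + (v x + ((- (n / x * spow p (v x)) - x * v x
       - \<alpha> * w x - spow (q + 1) (w x)) * x - spow p (v x) * 1) / (x * x)) * x powr \<theta>) (at x)"
    using \<open>x > 0\<close>
    by (intro DERIV_mult DERIV_add DERIV_divide has_real_derivative_powr sol_DERIV[OF sol] DERIV_ident) auto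
  moreover have "x powr \<theta> = x powr (\<theta> - 1) * x"
    using \<open>x > 0\<close> by (simp add: powr_diff)
  ultimately show ?thesis
    using \<open>x > 0\<close> by (elim DERIV_cong) (simp add: field_simps)
qed

text \<open>Where the rescaled sum is positive, damping and nonlinearity help or are bounded by
  \<open>\<bar>u\<bar> / r\<close>, so only the fast decay of \<open>u / r\<close> matters, whatever
  the value of \<open>q\<close>.\<close>

lemma decay_improve:
  assumes dec: "decay A \<gamma>" and \<gamma>: "0 \<le> \<gamma>" "\<gamma> \<le> \<alpha>"
  shows "decay A (min \<alpha> (\<gamma> + gap))"
proof -
  obtain B where B: "B \<ge> 0"
    "\<And>w v r. sol w v \<Longrightarrow> \<bar>w 0\<bar> \<le> A \<Longrightarrow> 1 \<le> r \<Longrightarrow> \<bar>spow p (v r)\<bar> / r \<le> B * r powr - (\<gamma> + 2 * gap)"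
    using slope_decay[OF assms] by blast
  define \<theta> where "\<theta> = min \<alpha> (\<gamma> + gap)"
  have \<theta>: "\<theta> \<le> \<alpha>" "\<theta> \<le> \<gamma> + gap" by (auto simp: \<theta>_def)
  define H where "H = \<bar>\<alpha> - (n + 1)\<bar> + A powr (q - 1)"
  have "H \<ge> 0" by (simp add: H_def)
  define K where "K = H * B / gap"
  have "K \<ge> 0" using \<open>H \<ge> 0\<close> B gap_pos by (simp add: K_def)
  have one_sided: "r powr \<theta> * (w r + spow p (v r) / r) \<le> \<bar>A\<bar> + B + K"
    if sol: "sol w v" and wA: "\<bar>w 0\<bar> \<le> A" and "1 \<le> r" for w v r
  proof -
    \<comment> \<open>\<open>\<bar>A\<bar> + B\<close> covers x = 1, and
      \<open>K * (1 - x powr - gap)\<close> is the integral of the forcing bound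
      \<open>H * B * x powr (- gap - 1)\<close>. Of the two gaps won for \<open>u / r\<close>, one
      raises the exponent and the other makes this bound integrable.\<close>
    define d where "d x = x powr \<theta> * (w x + spow p (v x) / x) - (\<bar>A\<bar> + B + K * (1 - x powr - gap))" for x
    have "d r \<le> 0"
    proof (rule upper_barrier[OF \<open>1 \<le> r\<close>])
      show "continuous_on {1..r} d"
        unfolding d_def by (auto intro!: continuous_intros sol_contD[OF sol])
      show "d 1 \<le> 0"
        using B(2)[OF sol wA, of 1] sol_bound[OF sol, of 1] wA by (simp add: d_def)
      fix x assume x: "1 < x" "d x > 0"
      let ?z = "w x + spow p (v x) / x"
      let ?G = "(\<theta> - \<alpha>) * ?z + (\<alpha> - (n + 1)) * (spow p (v x) / x) - spow (q + 1) (w x)"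
      have "(d has_real_derivative
          x powr (\<theta> - 1) * ?G - (0 + K * (0 - (- gap * x powr (- gap - 1))))) (at x)"
        unfolding d_def using \<open>x > 1\<close>
        by (intro DERIV_diff DERIV_add DERIV_cmult DERIV_const DERIV_rescaled[OF sol]
            has_real_derivative_powr) auto
      then have "(d has_real_derivative x powr (\<theta> - 1) * ?G - K * (gap * x powr (- gap - 1))) (at x)"
        by simp
      moreover have "x powr (\<theta> - 1) * ?G - K * (gap * x powr (- gap - 1)) \<le> 0"
      proof -
        have "x powr - gap \<le> x powr 0" using x gap_pos by (intro powr_mono) auto
        then have "0 \<le> K * (1 - x powr - gap)" using \<open>K \<ge> 0\<close> x by simp
        then have "x powr \<theta> * ?z > 0" using x B by (simp add: d_def)
        then have "?z > 0" using x by (simp add: zero_less_mult_iff)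
        then have 1: "(\<theta> - \<alpha>) * ?z \<le> 0" using \<theta> by (simp add: mult_nonpos_nonneg)
        \<comment> \<open>For \<open>w x \<ge> 0\<close> the sign is favourable; for
          \<open>w x < 0\<close> the positivity of \<open>?z\<close> forces
          \<open>\<bar>w x\<bar> \<le> \<bar>spow p (v x)\<bar> / x\<close>.\<close>
        have 2: "- spow (q + 1) (w x) \<le> A powr (q - 1) * (\<bar>spow p (v x)\<bar> / x)"
        proof (cases "w x \<ge> 0")
          case True
          then have "spow (q + 1) (w x) \<ge> 0" by simp
          moreover have "A powr (q - 1) * (\<bar>spow p (v x)\<bar> / x) \<ge> 0" using x by simp
          ultimately show ?thesis by linarith
        next
          case False
          have "\<bar>spow (q + 1) (w x)\<bar> \<le> A powr (q - 1) * \<bar>w x\<bar>"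
            using sol_bound[OF sol, of x] wA x by (intro abs_spow_q_le) auto
          also have "\<dots> \<le> A powr (q - 1) * (\<bar>spow p (v x)\<bar> / x)"
          proof (intro mult_left_mono)
            have "spow p (v x) / x \<le> \<bar>spow p (v x)\<bar> / x"
              using x by (intro divide_right_mono) auto
            then show "\<bar>w x\<bar> \<le> \<bar>spow p (v x)\<bar> / x" using \<open>?z > 0\<close> False by linarith
          qed simp
          finally show ?thesis by linarith
        qed
        have 3: "(\<alpha> - (n + 1)) * (spow p (v x) / x) \<le> \<bar>\<alpha> - (n + 1)\<bar> * (\<bar>spow p (v x)\<bar> / x)"
          using x abs_ge_self[of "(\<alpha> - (n + 1)) * (spow p (v x) / x)"] by (simp add: abs_mult)
        have "?G \<le> H * (\<bar>spow p (v x)\<bar> / x)"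
          unfolding H_def distrib_right using 1 2 3 by linarith
        also have "\<dots> \<le> H * (B * x powr - (\<gamma> + 2 * gap))"
          using B(2)[OF sol wA, of x] x \<open>H \<ge> 0\<close> by (intro mult_left_mono) auto
        finally have "x powr (\<theta> - 1) * ?G \<le> x powr (\<theta> - 1) * (H * (B * x powr - (\<gamma> + 2 * gap)))"
          by (intro mult_left_mono) auto
        also have "\<dots> = H * B * x powr (\<theta> - 1 - (\<gamma> + 2 * gap))"
          by (simp only: diff_conv_add_uminus[of "\<theta> - 1"] powr_add mult_ac)
        also have "\<dots> \<le> H * B * x powr (- gap - 1)"
          using \<theta> x \<open>H \<ge> 0\<close> B by (intro mult_left_mono powr_mono) auto
        finally show ?thesis using gap_pos by (simp add: K_def)
      qed
      ultimately show "\<exists>D\<le>0. (d has_real_derivative D) (at x)" by blast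
    qed
    then have "r powr \<theta> * (w r + spow p (v r) / r) \<le> \<bar>A\<bar> + B + K * (1 - r powr - gap)"
      by (simp add: d_def)
    also have "\<dots> \<le> \<bar>A\<bar> + B + K * 1"
      using \<open>K \<ge> 0\<close> by (intro add_left_mono mult_left_mono) auto
    finally show ?thesis by simp
  qed
  have "\<bar>w r\<bar> \<le> (\<bar>A\<bar> + B + K + B) * r powr - \<theta>"
    if sol: "sol w v" and wA: "\<bar>w 0\<bar> \<le> A" and "1 \<le> r" for w v r
  proof -
    have "- (r powr \<theta> * (w r + spow p (v r) / r)) \<le> \<bar>A\<bar> + B + K"
      using one_sided[OF sol_minus[OF sol] _ \<open>1 \<le> r\<close>] wA by (simp add: algebra_simps)
    then have "\<bar>r powr \<theta> * (w r + spow p (v r) / r)\<bar> \<le> \<bar>A\<bar> + B + K"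
      using one_sided[OF that] by linarith
    then have "r powr \<theta> * \<bar>w r + spow p (v r) / r\<bar> \<le> \<bar>A\<bar> + B + K"
      by (simp add: abs_mult)
    then have "\<bar>w r + spow p (v r) / r\<bar> \<le> (\<bar>A\<bar> + B + K) * r powr - \<theta>"
      using \<open>1 \<le> r\<close> by (simp add: powr_minus field_simps)
    moreover have "\<bar>spow p (v r) / r\<bar> \<le> B * r powr - \<theta>"
    proof -
      have "\<bar>spow p (v r) / r\<bar> \<le> B * r powr - (\<gamma> + 2 * gap)"
        using B(2)[OF that] \<open>1 \<le> r\<close> by simp
      also have "\<dots> \<le> B * r powr - \<theta>"
        using B \<theta> gap_pos \<open>1 \<le> r\<close> by (intro mult_left_mono powr_mono) auto
      finally show ?thesis .
    qed
    ultimately show ?thesis unfolding distrib_right by linarith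
  qed
  then show ?thesis
    unfolding decay_def \<theta>_def[symmetric] using B \<open>K \<ge> 0\<close>
    by (intro exI[of _ "\<bar>A\<bar> + B + K + B"]) auto
qed

text \<open>Each application of \<open>decay_improve\<close> gains the same amount
  \<open>gap\<close> until \<open>\<alpha>\<close> is reached, so finitely many suffice; exponent 0
  is \<open>sol_bound\<close>.\<close>

lemma decay_alpha: "decay A \<alpha>"
proof -
  have "decay A (min \<alpha> (real k * gap))" for k
  proof (induction k)
    case 0
    have "\<bar>w r\<bar> \<le> \<bar>A\<bar>" if "sol w v" "\<bar>w 0\<bar> \<le> A" "1 \<le> r" for w v r
      using sol_bound[OF that(1), of r] that by auto
    then show ?case using alpha_pos unfolding decay_def by (intro exI[of _ "\<bar>A\<bar>"]) auto
  next
    case (Suc k)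
    have "decay A (min \<alpha> (min \<alpha> (real k * gap) + gap))"
      using alpha_pos gap_pos by (intro decay_improve Suc) auto
    also have "min \<alpha> (min \<alpha> (real k * gap) + gap) = min \<alpha> (real (Suc k) * gap)"
      using gap_pos by (auto simp: min_def algebra_simps)
    finally show ?case .
  qed
  moreover obtain k where "\<alpha> < real k * gap"
    using reals_Archimedean3[OF gap_pos] by blast
  ultimately have "decay A (min \<alpha> (real k * gap))" by blast
  then show ?thesis using \<open>\<alpha> < real k * gap\<close> by (simp add: min_def)
qed

section \<open>Uniform convergence of the rescaled solution\<close>

text \<open>For \<open>\<theta> = \<alpha>\<close> the damping term in \<open>DERIV_rescaled\<close>
  vanishes and the remaining derivative is integrable.\<close>

lemma tail_estimate:
  obtains C \<eta> where "C \<ge> 0" "\<eta> > 0"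
    "\<And>w v r s. sol w v \<Longrightarrow> \<bar>w 0\<bar> \<le> A \<Longrightarrow> 1 \<le> r \<Longrightarrow> r \<le> s \<Longrightarrow>
       \<bar>s powr \<alpha> * w s - r powr \<alpha> * w r\<bar> \<le> C * r powr - \<eta>"
proof -
  obtain C where C: "C \<ge> 0"
    "\<And>w v r. sol w v \<Longrightarrow> \<bar>w 0\<bar> \<le> A \<Longrightarrow> 1 \<le> r \<Longrightarrow> \<bar>w r\<bar> \<le> C * r powr - \<alpha>"
    using decay_alpha[of A] unfolding decay_def by blast
  obtain B where B: "B \<ge> 0"
    "\<And>w v r. sol w v \<Longrightarrow> \<bar>w 0\<bar> \<le> A \<Longrightarrow> 1 \<le> r \<Longrightarrow> \<bar>spow p (v r)\<bar> / r \<le> B * r powr - (\<alpha> + 2 * gap)"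
    using slope_decay[OF decay_alpha[of A]] alpha_pos by (metis less_imp_le order_refl)
  \<comment> \<open>The surplus decay over \<open>x powr - \<alpha>\<close>: \<open>2 * gap\<close>
    for \<open>u / x\<close> and \<open>\<alpha> * (q - 1)\<close> for
    \<open>\<bar>w\<bar> powr q\<close>.\<close>
  define \<eta> where "\<eta> = min (2 * gap) (\<alpha> * (q - 1))"
  have \<eta>: "\<eta> > 0" "\<eta> \<le> 2 * gap" "\<eta> \<le> \<alpha> * (q - 1)"
    using gap_pos alpha_pos q_gt_1 by (auto simp: \<eta>_def)
  define K where "K = (\<bar>\<alpha> - (n + 1)\<bar> * B + C powr q) / \<eta>"
  have "K \<ge> 0" using B \<eta> by (simp add: K_def)
  have "\<bar>s powr \<alpha> * w s - r powr \<alpha> * w r\<bar> \<le> (K + 2 * B) * r powr - \<eta>"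
    if sol: "sol w v" and wA: "\<bar>w 0\<bar> \<le> A" and r: "1 \<le> r" "r \<le> s" for w v r s
  proof -
    define J where "J x = x powr \<alpha> * (w x + spow p (v x) / x)" for x
    let ?J' = "\<lambda>x. x powr (\<alpha> - 1) * ((\<alpha> - \<alpha>) * (w x + spow p (v x) / x)
       + (\<alpha> - (n + 1)) * (spow p (v x) / x) - spow (q + 1) (w x))"
    have J': "(J has_real_derivative ?J' x) (at x)" if "r < x" for x
      unfolding J_def using that r by (intro DERIV_rescaled[OF sol]) auto
    have "\<bar>?J' x\<bar> \<le> K * (\<eta> * x powr (- \<eta> - 1))" if "r < x" for x
    proof -
      have x: "x > 1" using that r by simp
      have "\<bar>(\<alpha> - (n + 1)) * (spow p (v x) / x)\<bar> = \<bar>\<alpha> - (n + 1)\<bar> * (\<bar>spow p (v x)\<bar> / x)"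
        using x by (simp add: abs_mult)
      also have "\<dots> \<le> \<bar>\<alpha> - (n + 1)\<bar> * (B * x powr - (\<alpha> + 2 * gap))"
        using B(2)[OF sol wA, of x] x by (intro mult_left_mono) auto
      also have "\<dots> \<le> \<bar>\<alpha> - (n + 1)\<bar> * (B * x powr - (\<alpha> + \<eta>))"
        using x \<eta> B by (intro mult_left_mono powr_mono) auto
      finally have 1: "\<bar>(\<alpha> - (n + 1)) * (spow p (v x) / x)\<bar> \<le> \<bar>\<alpha> - (n + 1)\<bar> * B * x powr - (\<alpha> + \<eta>)"
        by (simp add: mult.assoc)
      have "\<bar>spow (q + 1) (w x)\<bar> = \<bar>w x\<bar> powr q"
        using abs_spow[of "q + 1"] q_gt_1 by simp
      also have "\<dots> \<le> (C * x powr - \<alpha>) powr q"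
        using C(2)[OF sol wA, of x] x q_gt_1 by (intro powr_mono2) auto
      also have "\<dots> = C powr q * x powr (- \<alpha> * q)"
        using C x by (simp add: powr_mult powr_powr)
      also have "\<dots> \<le> C powr q * x powr - (\<alpha> + \<eta>)"
        using x \<eta> by (intro mult_left_mono powr_mono) (auto simp: algebra_simps)
      finally have 2: "\<bar>spow (q + 1) (w x)\<bar> \<le> C powr q * x powr - (\<alpha> + \<eta>)" .
      have "\<bar>?J' x\<bar> = x powr (\<alpha> - 1) * \<bar>(\<alpha> - (n + 1)) * (spow p (v x) / x) - spow (q + 1) (w x)\<bar>"
        using x by (simp add: abs_mult)
      also have "\<dots> \<le> x powr (\<alpha> - 1) * ((\<bar>\<alpha> - (n + 1)\<bar> * B + C powr q) * x powr - (\<alpha> + \<eta>))"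
        using 1 2 unfolding distrib_right by (intro mult_left_mono) (linarith, simp)
      also have "\<dots> = K * (\<eta> * (x powr (\<alpha> - 1) * x powr - (\<alpha> + \<eta>)))"
        using \<eta> by (simp add: K_def)
      also have "x powr (\<alpha> - 1) * x powr - (\<alpha> + \<eta>) = x powr (- \<eta> - 1)"
        unfolding powr_add[symmetric] by (rule arg_cong[where f = "(powr) x"]) simp
      finally show ?thesis .
    qed
    moreover have "((\<lambda>x. - K * x powr - \<eta>) has_real_derivative K * (\<eta> * x powr (- \<eta> - 1))) (at x)"
      if "r < x" for x
      using DERIV_cmult[OF has_real_derivative_powr[of x "- \<eta>"], of "- K"] that r by simp
    moreover have "continuous_on {r..s} J"
      unfolding J_def using r by (auto intro!: continuous_intros sol_contD[OF sol])
    moreover have "continuous_on {r..s} (\<lambda>x. - K * x powr - \<eta>)"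
      using r by (auto intro!: continuous_intros)
    ultimately have "\<bar>J s - J r\<bar> \<le> - K * s powr - \<eta> - (- K * r powr - \<eta>)"
      using J' by (intro DERIV_abs_le_imp_abs_diff_le[OF r(2)])
    moreover have "K * s powr - \<eta> \<ge> 0" using \<open>K \<ge> 0\<close> by simp
    ultimately have "\<bar>J s - J r\<bar> \<le> K * r powr - \<eta>" by linarith
    \<comment> \<open>Returning from \<open>J\<close> to the rescaled \<open>w\<close> costs
      \<open>x powr \<alpha> * u / x\<close>, which is of the same order.\<close>
    moreover have "\<bar>J x - x powr \<alpha> * w x\<bar> \<le> B * r powr - \<eta>" if "r \<le> x" for x
    proof -
      have x: "x \<ge> 1" using that r by simp
      have "\<bar>J x - x powr \<alpha> * w x\<bar> = x powr \<alpha> * (\<bar>spow p (v x)\<bar> / x)"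
        using x by (simp add: J_def distrib_left abs_mult)
      also have "\<dots> \<le> x powr \<alpha> * (B * x powr - (\<alpha> + 2 * gap))"
        using B(2)[OF sol wA x] by (intro mult_left_mono) auto
      also have "\<dots> = B * x powr - (2 * gap)"
        using x by (simp add: mult.left_commute[of _ B] flip: powr_add)
      also have "\<dots> \<le> B * x powr - \<eta>"
        using x \<eta> B by (intro mult_left_mono powr_mono) auto
      also have "\<dots> \<le> B * r powr - \<eta>"
        using that r \<eta> B by (intro mult_left_mono powr_mono2') auto
      finally show ?thesis .
    qed
    from this[OF r(2)] this[OF order.refl] have
      "\<bar>J s - s powr \<alpha> * w s\<bar> \<le> B * r powr - \<eta>" "\<bar>J r - r powr \<alpha> * w r\<bar> \<le> B * r powr - \<eta>" .
    ultimately have "\<bar>s powr \<alpha> * w s - r powr \<alpha> * w r\<bar> \<le> K * r powr - \<eta> + 2 * (B * r powr - \<eta>)"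
      by linarith
    then show ?thesis by (simp add: algebra_simps)
  qed
  then show ?thesis
    using \<open>K \<ge> 0\<close> B \<eta>(1) by (intro that[of "K + 2 * B" \<eta>]) auto
qed

text \<open>\<open>Lim\<close> is a description, so convergence has to be established before its
  value can be used; the tail estimate is a Cauchy condition.\<close>

lemma uniform_limit_at_top:
  obtains C \<eta> where "C \<ge> 0" "\<eta> > 0"
    "\<And>w v r. sol w v \<Longrightarrow> \<bar>w 0\<bar> \<le> A \<Longrightarrow> 1 \<le> r \<Longrightarrow>
       \<bar>r powr \<alpha> * w r - Lim at_top (\<lambda>r. r powr \<alpha> * w r)\<bar> \<le> C * r powr - \<eta>"
proof -
  obtain C \<eta> where C: "C \<ge> 0" "\<eta> > 0"
    "\<And>w v r s. sol w v \<Longrightarrow> \<bar>w 0\<bar> \<le> A \<Longrightarrow> 1 \<le> r \<Longrightarrow> r \<le> s \<Longrightarrow>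
       \<bar>s powr \<alpha> * w s - r powr \<alpha> * w r\<bar> \<le> C * r powr - \<eta>"
    using tail_estimate[of A] by metis
  have lim0: "((\<lambda>r::real. C * r powr - \<eta>) \<longlongrightarrow> C * 0) at_top"
    using C(2) by (intro tendsto_intros tendsto_neg_powr filterlim_ident) auto
  have "\<bar>r powr \<alpha> * w r - Lim at_top (\<lambda>r. r powr \<alpha> * w r)\<bar> \<le> C * r powr - \<eta>"
    if sol: "sol w v" and wA: "\<bar>w 0\<bar> \<le> A" and "1 \<le> r" for w v r
  proof -
    define g where "g r = r powr \<alpha> * w r" for r
    have g: "\<bar>g s - g r\<bar> \<le> C * r powr - \<eta>" if "1 \<le> r" "r \<le> s" for r s
      using C(3)[OF sol wA that] by (simp add: g_def)
    have "Cauchy (\<lambda>k. g (real k))"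
    proof (rule CauchyI')
      fix e :: real assume "e > 0"
      then have "\<forall>\<^sub>F k in sequentially. C * real k powr - \<eta> < e"
        using order_tendstoD(2)[OF filterlim_compose[OF lim0 filterlim_real_sequentially]] by simp
      then have "\<forall>\<^sub>F k in sequentially. C * real k powr - \<eta> < e \<and> k \<ge> 1"
        using eventually_ge_at_top by (rule eventually_conj)
      then obtain k where k: "C * real k powr - \<eta> < e" "k \<ge> 1"
        by (auto simp: eventually_sequentially)
      have "dist (g (real i)) (g (real j)) < e" if "i \<ge> k" "j > i" for i j
      proof -
        have "C * real i powr - \<eta> \<le> C * real k powr - \<eta>"
          using that k C by (intro mult_left_mono powr_mono2') auto
        then show ?thesis
          using g[of "real i" "real j"] k that by (simp add: dist_real_def abs_minus_commute)
      qed
      then show "\<exists>M. \<forall>i\<ge>M. \<forall>j>i. dist (g (real i)) (g (real j)) < e" by blast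
    qed
    then obtain l where l: "(\<lambda>k. g (real k)) \<longlonglongrightarrow> l"
      using Cauchy_convergent convergent_def by blast
    \<comment> \<open>Letting the far endpoint run through the integers with real \<open>r\<close>
      fixed turns the sequential limit into a limit over the reals, with rate.\<close>
    have gl: "\<bar>g r - l\<bar> \<le> C * r powr - \<eta>" if "1 \<le> r" for r
    proof -
      have "(\<lambda>k. \<bar>g (real k) - g r\<bar>) \<longlonglongrightarrow> \<bar>l - g r\<bar>"
        by (intro tendsto_intros l)
      moreover have "\<forall>\<^sub>F k in sequentially. \<bar>g (real k) - g r\<bar> \<le> C * r powr - \<eta>"
        using eventually_ge_at_top[of "nat \<lceil>r\<rceil>"] g[OF that]
        by (rule eventually_mono) linarith
      ultimately have "\<bar>l - g r\<bar> \<le> C * r powr - \<eta>"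
        by (intro tendsto_upperbound) auto
      then show ?thesis by (simp add: abs_minus_commute)
    qed
    have "(g \<longlongrightarrow> l) at_top"
    proof (rule Lim_null_comparison[THEN Lim_null[THEN iffD2]])
      show "\<forall>\<^sub>F r in at_top. norm (g r - l) \<le> C * r powr - \<eta>"
        using eventually_ge_at_top[of 1] by (rule eventually_mono) (simp add: gl)
      show "((\<lambda>r. C * r powr - \<eta>) \<longlongrightarrow> 0) at_top" using lim0 by simp
    qed
    then have "Lim at_top g = l" by (intro tendsto_Lim) auto
    then show ?thesis using gl[OF \<open>1 \<le> r\<close>] by (simp add: g_def[abs_def])
  qed
  then show ?thesis using that C by blast
qed

section \<open>Continuous dependence away from the origin\<close>

text \<open>The summand \<open>(real n + 1) * x\<close> arises from differentiating the weight
  \<open>r ^ (n + 1)\<close> in front of \<open>w\<close> in the flux.\<close>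

definition reaction :: "real \<Rightarrow> real" where
  "reaction x = (real n + 1) * x - \<alpha> * x - spow (q + 1) x"

lemma reaction_Lipschitz:
  obtains C where "C \<ge> 0"
    "\<And>x y. \<bar>x\<bar> \<le> A \<Longrightarrow> \<bar>y\<bar> \<le> A \<Longrightarrow> \<bar>reaction x - reaction y\<bar> \<le> C * \<bar>x - y\<bar>"
proof -
  define C where "C = \<bar>real n + 1 - \<alpha>\<bar> + q * A powr (q - 1)"
  have "C \<ge> 0" using q_gt_1 by (simp add: C_def)
  moreover have "\<bar>reaction x - reaction y\<bar> \<le> C * \<bar>x - y\<bar>" if "\<bar>x\<bar> \<le> A" "\<bar>y\<bar> \<le> A" for x y
  proof -
    have "norm (spow (q + 1) x - spow (q + 1) y) \<le> (q * A powr (q - 1)) * norm (x - y)"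
    proof (rule field_differentiable_bound[of "{- A..A}"])
      fix z assume z: "z \<in> {- A..A}"
      show "(spow (q + 1) has_field_derivative q * \<bar>z\<bar> powr (q - 1)) (at z within {- A..A})"
        using DERIV_spow[of "q + 1" z] q_gt_1 by (auto intro: DERIV_subset)
      show "norm (q * \<bar>z\<bar> powr (q - 1)) \<le> q * A powr (q - 1)"
        using z q_gt_1 by (auto simp: abs_mult intro!: powr_mono2)
    qed (use that in auto)
    moreover have "reaction x - reaction y = (real n + 1 - \<alpha>) * (x - y) - (spow (q + 1) x - spow (q + 1) y)"
      by (simp add: reaction_def algebra_simps)
    moreover have "\<bar>(real n + 1 - \<alpha>) * (x - y)\<bar> = \<bar>real n + 1 - \<alpha>\<bar> * \<bar>x - y\<bar>"
      by (simp add: abs_mult)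
    ultimately show ?thesis
      unfolding C_def distrib_right by simp
  qed
  ultimately show ?thesis by (rule that)
qed

lemma DERIV_power_times:
  fixes g :: "real \<Rightarrow> real"
  assumes "(g has_real_derivative D) (at x)" "x > 0"
  shows "((\<lambda>r. r ^ n * g r) has_real_derivative x ^ n * (n / x * g x + D)) (at x)"
proof -
  have "real n * x ^ (n - 1) = x ^ n * (n / x)"
    using \<open>x > 0\<close> by (cases n) auto
  then show ?thesis
    using assms by (auto intro!: derivative_eq_intros simp: algebra_simps)
qed

text \<open>The weight \<open>r ^ n\<close> removes \<open>n / r * u\<close> and the summand
  \<open>r * w\<close> removes \<open>r * v\<close>. The right side involves \<open>w\<close> alone,
  so differences of fluxes are controlled by differences of \<open>w\<close>.\<close>

lemma DERIV_flux:
  assumes sol: "sol w v" and "x > 0"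
  shows "((\<lambda>r. r ^ n * (spow p (v r) + r * w r)) has_real_derivative x ^ n * reaction (w x)) (at x)"
proof -
  have "((\<lambda>r. r ^ n * (spow p (v r) + r * w r)) has_real_derivative
    x ^ n * (n / x * (spow p (v x) + x * w x) + (- (n / x * spow p (v x)) - x * v x - \<alpha> * w x
      - spow (q + 1) (w x) + (1 * w x + v x * x)))) (at x)"
    using \<open>x > 0\<close> by (intro DERIV_power_times DERIV_add DERIV_mult DERIV_ident sol_DERIV[OF sol])
  then show ?thesis
    using \<open>x > 0\<close> by (elim DERIV_cong) (simp add: reaction_def field_simps)
qed

text \<open>The majorant \<open>\<Phi>\<close> is left free: it will be a multiple of the integral
  of the difference away from 0, and a multiple of \<open>x ^ Suc n\<close> near 0.\<close>

lemma flux_diff_le: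
  assumes sol: "sol w1 v1" "sol w2 v2" and "0 \<le> r"
    and \<Phi>: "continuous_on {0..r} \<Phi>" "\<Phi> 0 = 0"
      "\<And>x. 0 < x \<Longrightarrow> x < r \<Longrightarrow> (\<Phi> has_real_derivative \<Phi>' x) (at x)"
    and le: "\<And>x. 0 < x \<Longrightarrow> x < r \<Longrightarrow> x ^ n * \<bar>reaction (w1 x) - reaction (w2 x)\<bar> \<le> \<Phi>' x"
  shows "r ^ n * \<bar>spow p (v1 r) - spow p (v2 r) + r * (w1 r - w2 r)\<bar> \<le> \<Phi> r"
proof -
  define V where "V x = x ^ n * (spow p (v1 x) + x * w1 x) - x ^ n * (spow p (v2 x) + x * w2 x)" for x
  have "\<bar>V r - V 0\<bar> \<le> \<Phi> r - \<Phi> 0"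
  proof (rule DERIV_abs_le_imp_abs_diff_le[OF \<open>0 \<le> r\<close> _ \<Phi>(1) _ \<Phi>(3)])
    show "continuous_on {0..r} V"
      unfolding V_def by (intro continuous_intros sol_contD[OF sol(1)] sol_contD[OF sol(2)]) auto
    show "(V has_real_derivative x ^ n * reaction (w1 x) - x ^ n * reaction (w2 x)) (at x)"
      if "0 < x" for x
      unfolding V_def using that by (intro DERIV_diff DERIV_flux sol)
    show "\<bar>x ^ n * reaction (w1 x) - x ^ n * reaction (w2 x)\<bar> \<le> \<Phi>' x" if "0 < x" "x < r" for x
      using le[OF that] that by (simp add: abs_mult flip: right_diff_distrib)
  qed
  \<comment> \<open>For \<open>n = 0\<close> the weight \<open>0 ^ n\<close> is 1, so this rests on
    \<open>v1 0 = v2 0 = 0\<close>.\<close>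
  moreover have "V 0 = 0" using sol by (simp add: V_def sol_0)
  moreover have "V r = r ^ n * (spow p (v1 r) - spow p (v2 r) + r * (w1 r - w2 r))"
    by (simp add: V_def algebra_simps)
  ultimately show ?thesis using \<Phi>(2) \<open>0 \<le> r\<close> by (simp add: abs_mult)
qed

lemma DERIV_integral_abs_diff:
  assumes sol: "sol w1 v1" "sol w2 v2"
  shows "continuous_on {0..r} (\<lambda>x. integral {0..x} (\<lambda>s. \<bar>w1 s - w2 s\<bar>))"
    and "0 < x \<Longrightarrow> x < r \<Longrightarrow>
      ((\<lambda>x. integral {0..x} (\<lambda>s. \<bar>w1 s - w2 s\<bar>)) has_real_derivative \<bar>w1 x - w2 x\<bar>) (at x)"
proof -
  have cont: "continuous_on {0..r} (\<lambda>s. \<bar>w1 s - w2 s\<bar>)"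
    by (intro continuous_intros sol_contD[OF sol(1)] sol_contD[OF sol(2)]) auto
  note der = integral_has_real_derivative[OF cont]
  show "continuous_on {0..r} (\<lambda>x. integral {0..x} (\<lambda>s. \<bar>w1 s - w2 s\<bar>))"
    by (rule DERIV_continuous_on) (rule der)
  show "((\<lambda>x. integral {0..x} (\<lambda>s. \<bar>w1 s - w2 s\<bar>)) has_real_derivative \<bar>w1 x - w2 x\<bar>) (at x)"
    if "0 < x" "x < r"
    using der[of x] that at_within_Icc_at[of 0 x r] by simp
qed

text \<open>Since \<open>p\<close> may exceed 2, \<open>v\<close> is not a Lipschitz function of \<open>spow p v\<close>, and Gronwall's
  lemma does not apply directly. But \<open>spow p\<close> is increasing, so the difference of two solutions can
  only grow where it is dominated by the difference of their fluxes.\<close>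

lemma diff_le_integral:
  assumes sol: "sol w1 v1" "sol w2 v2" and A: "\<bar>w1 0\<bar> \<le> A" "\<bar>w2 0\<bar> \<le> A"
    and C: "C \<ge> 0" "\<And>x y. \<bar>x\<bar> \<le> A \<Longrightarrow> \<bar>y\<bar> \<le> A \<Longrightarrow> \<bar>reaction x - reaction y\<bar> \<le> C * \<bar>x - y\<bar>"
    and r: "0 < r0" "r0 \<le> r" "r \<le> R" and m: "m \<ge> 0" "w1 r0 - w2 r0 \<le> m"
  shows "w1 r - w2 r \<le> m + C * R ^ n / r0 ^ Suc n * integral {0..r} (\<lambda>s. \<bar>w1 s - w2 s\<bar>)"
proof -
  define H where "H x = integral {0..x} (\<lambda>s. \<bar>w1 s - w2 s\<bar>)" for x
  \<comment> \<open>\<open>C * R ^ n\<close> bounds the growth of the flux difference; solving for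
    \<open>w1 - w2\<close> divides by \<open>x ^ Suc n \<ge> r0 ^ Suc n\<close>.\<close>
  define K where "K = C * R ^ n / r0 ^ Suc n"
  have "K \<ge> 0" using C r by (simp add: K_def)
  have contH: "continuous_on {0..r} H"
    unfolding H_def by (rule DERIV_integral_abs_diff[OF sol])
  have H': "(H has_real_derivative \<bar>w1 x - w2 x\<bar>) (at x)" if "0 < x" "x < r" for x
    unfolding H_def using that by (rule DERIV_integral_abs_diff[OF sol])
  have H_nonneg: "H x \<ge> 0" if "x \<le> r" for x
    unfolding H_def
    by (intro integral_nonneg integrable_continuous_interval continuous_intros
        sol_contD[OF sol(1)] sol_contD[OF sol(2)]) auto
  define d where "d x = w1 x - w2 x - (m + K * H x)" for x
  have "d r \<le> 0"
  proof (rule upper_barrier[OF r(2)])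
    show "continuous_on {r0..r} d"
      unfolding d_def using r
      by (intro continuous_intros sol_contD[OF sol(1)] sol_contD[OF sol(2)]
          continuous_on_subset[OF contH]) auto
    show "d r0 \<le> 0" using m H_nonneg[OF r(2)] \<open>K \<ge> 0\<close> by (simp add: d_def add_increasing2)
    fix x assume x: "r0 < x" "x < r" "d x > 0"
    then have "x > 0" using r by simp
    have "x ^ n * \<bar>spow p (v1 x) - spow p (v2 x) + x * (w1 x - w2 x)\<bar> \<le> C * R ^ n * H x"
    proof (rule flux_diff_le[OF sol])
      show "continuous_on {0..x} (\<lambda>x. C * R ^ n * H x)"
        using x by (intro continuous_intros continuous_on_subset[OF contH]) auto
      show "((\<lambda>x. C * R ^ n * H x) has_real_derivative C * R ^ n * \<bar>w1 y - w2 y\<bar>) (at y)"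
        if "0 < y" "y < x" for y
        using that x by (intro DERIV_cmult H') auto
      show "y ^ n * \<bar>reaction (w1 y) - reaction (w2 y)\<bar> \<le> C * R ^ n * \<bar>w1 y - w2 y\<bar>"
        if "0 < y" "y < x" for y
      proof -
        have "\<bar>reaction (w1 y) - reaction (w2 y)\<bar> \<le> C * \<bar>w1 y - w2 y\<bar>"
          using sol_bound[OF sol(1), of y] sol_bound[OF sol(2), of y] A that by (intro C) auto
        then have "y ^ n * \<bar>reaction (w1 y) - reaction (w2 y)\<bar> \<le> R ^ n * (C * \<bar>w1 y - w2 y\<bar>)"
          using that x r by (intro mult_mono power_mono) auto
        then show ?thesis by (simp add: mult_ac)
      qed
    qed (use \<open>x > 0\<close> in \<open>auto simp: H_def\<close>)
    \<comment> \<open>Where \<open>d x > 0\<close>, the part \<open>x * (w1 x - w2 x)\<close> alone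
      exceeds the bound for the whole flux difference, so
      \<open>spow p (v1 x) - spow p (v2 x)\<close> must be negative.\<close>
    moreover have "C * R ^ n * H x < x ^ n * (x * (w1 x - w2 x))"
    proof -
      have "C * R ^ n * H x = r0 ^ Suc n * (K * H x)" using r by (simp add: K_def)
      also have "\<dots> \<le> x ^ Suc n * (K * H x)"
        using x r H_nonneg[of x] \<open>K \<ge> 0\<close> by (intro mult_right_mono power_mono) auto
      also have "\<dots> < x ^ Suc n * (w1 x - w2 x)"
        using x m \<open>x > 0\<close> by (intro mult_strict_left_mono) (auto simp: d_def)
      finally show ?thesis by (simp add: mult_ac)
    qed
    ultimately have "x ^ n * (spow p (v1 x) - spow p (v2 x) + x * (w1 x - w2 x)) < x ^ n * (x * (w1 x - w2 x))"
      using \<open>x > 0\<close> by (smt (verit) abs_ge_self mult_left_mono zero_le_power)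
    then have "spow p (v1 x) < spow p (v2 x)"
      using \<open>x > 0\<close> by (simp add: mult_less_cancel_left_pos)
    then have "v1 x < v2 x" using spow_less_iff p_gt_1 by blast
    moreover have "(d has_real_derivative v1 x - v2 x - (0 + K * \<bar>w1 x - w2 x\<bar>)) (at x)"
      unfolding d_def using \<open>x > 0\<close> x
      by (intro DERIV_diff DERIV_add DERIV_cmult DERIV_const H' sol_DERIV[OF sol(1)] sol_DERIV[OF sol(2)]) auto
    moreover have "K * \<bar>w1 x - w2 x\<bar> \<ge> 0" using \<open>K \<ge> 0\<close> by simp
    ultimately show "\<exists>D\<le>0. (d has_real_derivative D) (at x)" by (intro exI conjI) auto
  qed
  then show ?thesis by (simp add: d_def K_def H_def)
qed

text \<open>Applying \<open>diff_le_integral\<close> in both orders bounds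
  \<open>H' = \<bar>w1 - w2\<bar>\<close> by \<open>m + K * H\<close>, to which Gronwall applies.
  The constant involves a negative power of \<open>r0\<close>, so closeness on
  \<open>{0..r0}\<close> is taken as given.\<close>

lemma dependence_away_from_0:
  assumes "0 < r0" "0 \<le> R"
  obtains K where "K \<ge> 0"
    "\<And>w1 v1 w2 v2 m r. sol w1 v1 \<Longrightarrow> sol w2 v2 \<Longrightarrow> \<bar>w1 0\<bar> \<le> A \<Longrightarrow> \<bar>w2 0\<bar> \<le> A \<Longrightarrow> m \<ge> 0 \<Longrightarrow>
      (\<And>x. 0 \<le> x \<Longrightarrow> x \<le> r0 \<Longrightarrow> \<bar>w1 x - w2 x\<bar> \<le> m) \<Longrightarrow> 0 \<le> r \<Longrightarrow> r \<le> R \<Longrightarrow>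
      \<bar>w1 r - w2 r\<bar> \<le> K * m"
proof -
  obtain C where C: "C \<ge> 0"
    "\<And>x y. \<bar>x\<bar> \<le> A \<Longrightarrow> \<bar>y\<bar> \<le> A \<Longrightarrow> \<bar>reaction x - reaction y\<bar> \<le> C * \<bar>x - y\<bar>"
    using reaction_Lipschitz[of A] by blast
  define K where "K = C * R ^ n / r0 ^ Suc n"
  have "K \<ge> 0" using C assms by (simp add: K_def)
  have "\<bar>w1 r - w2 r\<bar> \<le> exp (K * R) * m"
    if sol: "sol w1 v1" "sol w2 v2" and A: "\<bar>w1 0\<bar> \<le> A" "\<bar>w2 0\<bar> \<le> A" and "m \<ge> 0"
      and near: "\<And>x. 0 \<le> x \<Longrightarrow> x \<le> r0 \<Longrightarrow> \<bar>w1 x - w2 x\<bar> \<le> m" and r: "0 \<le> r" "r \<le> R"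
    for w1 v1 w2 v2 m r
  proof -
    define H where "H x = integral {0..x} (\<lambda>s. \<bar>w1 s - w2 s\<bar>)" for x
    have contH: "continuous_on {0..r} H"
      unfolding H_def by (rule DERIV_integral_abs_diff[OF sol])
    have H': "(H has_real_derivative \<bar>w1 x - w2 x\<bar>) (at x)" if "0 < x" "x < r" for x
      unfolding H_def using that by (rule DERIV_integral_abs_diff[OF sol])
    have le: "\<bar>w1 x - w2 x\<bar> \<le> m + K * H x" if x: "0 \<le> x" "x \<le> r" for x
    proof (cases "x \<le> r0")
      case True
      have "H x \<ge> 0"
        unfolding H_def
        by (intro integral_nonneg integrable_continuous_interval continuous_intros
            sol_contD[OF sol(1)] sol_contD[OF sol(2)]) auto
      then show ?thesis using near[OF x(1) True] \<open>K \<ge> 0\<close> by (simp add: add_increasing2)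
    next
      case False
      have "w1 x - w2 x \<le> m + K * H x" "w2 x - w1 x \<le> m + K * H x"
        unfolding K_def H_def
        using diff_le_integral[OF sol A C assms(1) _ _ \<open>m \<ge> 0\<close>, of x R]
          diff_le_integral[OF sol(2,1) A(2,1) C assms(1) _ _ \<open>m \<ge> 0\<close>, of x R]
          near[of r0] False r x assms
        by (auto simp: abs_le_iff abs_minus_commute)
      then show ?thesis by linarith
    qed
    \<comment> \<open>Integrating factor of Gronwall's argument.\<close>
    define G where "G x = (m + K * H x) * exp (- K * x)" for x
    have "G r \<le> G 0"
    proof (rule DERIV_nonpos_imp_decreasing_open[OF r(1)])
      show "continuous_on {0..r} G"
        unfolding G_def by (intro continuous_intros contH)
      fix x assume x: "0 < x" "x < r"
      have "(G has_real_derivative (0 + K * \<bar>w1 x - w2 x\<bar>) * exp (- K * x)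
          + exp (- K * x) * (- K * 1) * (m + K * H x)) (at x)"
        unfolding G_def
        by (intro DERIV_mult DERIV_add DERIV_cmult DERIV_const DERIV_fun_exp DERIV_ident H' x)
      moreover have "(0 + K * \<bar>w1 x - w2 x\<bar>) * exp (- K * x)
          + exp (- K * x) * (- K * 1) * (m + K * H x)
          = - (K * exp (- K * x) * (m + K * H x - \<bar>w1 x - w2 x\<bar>))"
        by (simp add: algebra_simps)
      moreover have "K * exp (- K * x) * (m + K * H x - \<bar>w1 x - w2 x\<bar>) \<ge> 0"
        using le[of x] x \<open>K \<ge> 0\<close> by (intro mult_nonneg_nonneg) auto
      ultimately show "\<exists>y. (G has_real_derivative y) (at x) \<and> y \<le> 0"
        by (intro exI conjI) auto
    qed
    then have "(m + K * H r) * exp (- K * r) * exp (K * r) \<le> m * exp (K * r)"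
      by (intro mult_right_mono) (auto simp: G_def H_def)
    then have "m + K * H r \<le> m * exp (K * r)"
      by (simp add: mult.assoc flip: exp_add)
    also have "\<dots> \<le> m * exp (K * R)"
      using \<open>m \<ge> 0\<close> \<open>K \<ge> 0\<close> r by (intro mult_left_mono) (auto intro: mult_left_mono)
    finally show ?thesis using le[of r] r by (simp add: mult.commute)
  qed
  then show ?thesis by (intro that[of "exp (K * R)"]) auto
qed

section \<open>Continuous dependence near the origin\<close>

text \<open>\<open>- (r ^ n * u)\<close> has derivative \<open>r ^ n * ?f r\<close>, and near 0 the
  forcing \<open>?f\<close> lies between positive constants since \<open>w\<close> stays near
  \<open>w 0\<close> and \<open>r * v\<close> is small. Integration gives both bounds.\<close>

lemma slope_near_0:
  assumes "a > 0"
  obtains r0 b1 b2 where "0 < r0" "0 < b1"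
    "\<And>w v r. sol w v \<Longrightarrow> a / 2 \<le> w 0 \<Longrightarrow> w 0 \<le> 2 * a \<Longrightarrow> 0 < r \<Longrightarrow> r \<le> r0 \<Longrightarrow>
      b1 * r \<le> - spow p (v r) \<and> - spow p (v r) \<le> b2 * r"
proof -
  obtain M where M: "M \<ge> 1"
    "\<And>w v r. sol w v \<Longrightarrow> \<bar>w 0\<bar> \<le> 2 * a \<Longrightarrow> r \<ge> 0 \<Longrightarrow> \<bar>v r\<bar> \<le> M"
    using deriv_bound[of "2 * a"] by blast
  \<comment> \<open>The first entry keeps \<open>w \<ge> a / 2 - a / 4\<close>; the second keeps
    \<open>\<bar>x * v x\<bar>\<close> below half of \<open>\<alpha> * a / 4\<close>, which leaves
    \<open>c1\<close>.\<close>
  define r0 where "r0 = min (a / (4 * M)) (\<alpha> * a / (8 * M))"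
  have r0: "r0 > 0" "r0 * M \<le> a / 4" "r0 * M \<le> \<alpha> * a / 8"
    using M(1) \<open>a > 0\<close> alpha_pos by (auto simp: r0_def min_def field_simps)
  define c1 where "c1 = \<alpha> * a / 8"
  define c2 where "c2 = \<alpha> * a / 8 + \<alpha> * (2 * a) + (2 * a) powr (q - 1) * (2 * a)"
  have "c1 / (n + 1) * r \<le> - spow p (v r) \<and> - spow p (v r) \<le> c2 / (n + 1) * r"
    if sol: "sol w v" and w0: "a / 2 \<le> w 0" "w 0 \<le> 2 * a" and r: "0 < r" "r \<le> r0" for w v r
  proof -
    have wA: "\<bar>w 0\<bar> \<le> 2 * a" using w0 \<open>a > 0\<close> by auto
    let ?f = "\<lambda>x. x * v x + \<alpha> * w x + spow (q + 1) (w x)"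
    have f: "c1 \<le> ?f x \<and> ?f x \<le> c2" if x: "0 < x" "x < r" for x
    proof -
      have "\<bar>w x - w 0\<bar> \<le> M * x - M * 0"
        using x M(2)[OF sol wA]
        by (intro DERIV_abs_le_imp_abs_diff_le[where f' = v and g' = "\<lambda>_. M"] sol_contD[OF sol])
          (auto intro!: continuous_intros derivative_eq_intros sol_DERIV[OF sol])
      moreover have "M * x \<le> M * r0"
        using x r M(1) by (intro mult_left_mono) auto
      then have "M * x \<le> a / 4" using r0(2) by (simp add: mult.commute)
      ultimately have w: "w x \<ge> a / 4" using w0 by auto
      have w2: "\<bar>w x\<bar> \<le> 2 * a" using sol_bound[OF sol, of x] x wA by simp
      have "x * \<bar>v x\<bar> \<le> r0 * M"
        using x r M(2)[OF sol wA, of x] by (intro mult_mono) auto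
      then have "\<bar>x * v x\<bar> \<le> \<alpha> * a / 8" using r0(3) x by (simp add: abs_mult)
      moreover have "\<alpha> * (a / 4) \<le> \<alpha> * w x" "\<alpha> * w x \<le> \<alpha> * (2 * a)"
        using w w2 alpha_pos by (intro mult_left_mono; simp)+
      moreover have "spow (q + 1) (w x) \<ge> 0" using w \<open>a > 0\<close> by simp
      moreover have "\<bar>spow (q + 1) (w x)\<bar> \<le> (2 * a) powr (q - 1) * (2 * a)"
        by (rule order.trans[OF abs_spow_q_le[OF w2]]) (intro mult_left_mono w2, simp)
      ultimately show ?thesis unfolding c1_def c2_def by (intro conjI) linarith+
    qed
    define U where "U x = - (x ^ n * spow p (v x))" for x
    have U': "(U has_real_derivative x ^ n * ?f x) (at x)" if "0 < x" for x
    proof -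
      have "(U has_real_derivative - (x ^ n * (n / x * spow p (v x) + (- (n / x * spow p (v x)) - x * v x
          - \<alpha> * w x - spow (q + 1) (w x))))) (at x)"
        unfolding U_def using that by (intro DERIV_minus DERIV_power_times sol_DERIV[OF sol])
      then show ?thesis by (elim DERIV_cong) (simp add: algebra_simps)
    qed
    have P': "((\<lambda>x. c / (n + 1) * x ^ Suc n) has_real_derivative x ^ n * c) (at x)" for c x :: real
      by (auto intro!: derivative_eq_intros simp del: power_Suc)
    have contU: "continuous_on {0..r} U"
      unfolding U_def by (intro continuous_intros sol_contD[OF sol]) auto
    have U0: "U 0 = 0" using sol by (simp add: U_def sol_0)
    have "c1 / (n + 1) * r ^ Suc n - c1 / (n + 1) * 0 ^ Suc n \<le> U r - U 0"
      using r f by (intro DERIV_le_imp_diff_le[OF _ _ contU P' U'])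
        (auto intro!: continuous_intros mult_left_mono)
    then have "r ^ n * (c1 / (n + 1) * r) \<le> r ^ n * (- spow p (v r))"
      unfolding U0 by (simp add: U_def mult_ac)
    then have 1: "c1 / (n + 1) * r \<le> - spow p (v r)"
      using r by (subst (asm) mult_le_cancel_left_pos) auto
    have "U r - U 0 \<le> c2 / (n + 1) * r ^ Suc n - c2 / (n + 1) * 0 ^ Suc n"
      using r f by (intro DERIV_le_imp_diff_le[OF _ contU _ U' P'])
        (auto intro!: continuous_intros mult_left_mono)
    then have "r ^ n * (- spow p (v r)) \<le> r ^ n * (c2 / (n + 1) * r)"
      unfolding U0 by (simp add: U_def mult_ac)
    then have 2: "- spow p (v r) \<le> c2 / (n + 1) * r"
      using r by (subst (asm) mult_le_cancel_left_pos) auto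
    show ?thesis using 1 2 by blast
  qed
  moreover have "c1 / (n + 1) > 0" using alpha_pos \<open>a > 0\<close> by (simp add: c1_def)
  ultimately show ?thesis using r0(1) by (intro that[of r0 "c1 / (n + 1)" "c2 / (n + 1)"]) auto
qed

text \<open>Mean value inequality. The derivative is largest at the right end for
  \<open>s \<ge> 1\<close> and at the left end for \<open>s < 1\<close>; the sum of both values
  covers both cases.\<close>

lemma powr_Lipschitz_scaled:
  fixes b1 b2 s r x y :: real
  assumes "0 < b1" "0 < s" "0 < r" "b1 * r \<le> x" "x \<le> b2 * r" "b1 * r \<le> y" "y \<le> b2 * r"
  shows "\<bar>x powr s - y powr s\<bar> \<le> s * (b1 powr (s - 1) + b2 powr (s - 1)) * r powr (s - 1) * \<bar>x - y\<bar>"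
proof -
  have "norm (x powr s - y powr s) \<le> (s * (b1 powr (s - 1) + b2 powr (s - 1)) * r powr (s - 1)) * norm (x - y)"
  proof (rule field_differentiable_bound[of "{b1 * r..b2 * r}"])
    fix z assume z: "z \<in> {b1 * r..b2 * r}"
    have "0 < b1 * r" using assms by simp
    then have "z > 0" using z by auto
    then show "((\<lambda>z. z powr s) has_field_derivative s * z powr (s - 1)) (at z within {b1 * r..b2 * r})"
      by (rule has_field_derivative_at_within[OF has_real_derivative_powr])
    have "b2 * r > 0" using z \<open>z > 0\<close> by auto
    then have "b2 > 0" using \<open>r > 0\<close> by (simp add: zero_less_mult_iff)
    have "z powr (s - 1) \<le> (b1 * r) powr (s - 1) + (b2 * r) powr (s - 1)"
    proof (cases "s \<ge> 1")
      case True
      then have "z powr (s - 1) \<le> (b2 * r) powr (s - 1)"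
        using z \<open>z > 0\<close> by (intro powr_mono2) auto
      then show ?thesis by (simp add: add_increasing)
    next
      case False
      then have "z powr (s - 1) \<le> (b1 * r) powr (s - 1)"
        using z \<open>0 < b1 * r\<close> by (intro powr_mono2') auto
      then show ?thesis by (simp add: add_increasing2)
    qed
    also have "\<dots> = (b1 powr (s - 1) + b2 powr (s - 1)) * r powr (s - 1)"
      using assms \<open>b2 > 0\<close> by (simp add: powr_mult distrib_right)
    finally show "norm (s * z powr (s - 1)) \<le> s * (b1 powr (s - 1) + b2 powr (s - 1)) * r powr (s - 1)"
      using \<open>s > 0\<close> by (simp add: abs_mult mult.assoc)
  qed (use assms in auto)
  then show ?thesis by simp
qed

text \<open>When \<open>w 0 = a > 0\<close>, the quantity \<open>- spow p v\<close> is comparable to \<open>r\<close> near the origin, and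
  inverting \<open>spow p\<close> there costs the factor \<open>r powr (1 / (p - 1) - 1)\<close>, which is integrable even
  for \<open>p > 2\<close>.\<close>

lemma dependence_near_0:
  assumes "a > 0"
  obtains r0 where "r0 > 0"
    "\<And>w1 v1 w2 v2 r. sol w1 v1 \<Longrightarrow> sol w2 v2 \<Longrightarrow> a / 2 \<le> w1 0 \<Longrightarrow> w1 0 \<le> 2 * a \<Longrightarrow>
      a / 2 \<le> w2 0 \<Longrightarrow> w2 0 \<le> 2 * a \<Longrightarrow> 0 \<le> r \<Longrightarrow> r \<le> r0 \<Longrightarrow>
      \<bar>w1 r - w2 r\<bar> \<le> 2 * \<bar>w1 0 - w2 0\<bar>"
proof -
  obtain R b1 b2 where R: "0 < R" "0 < b1"
    "\<And>w v r. sol w v \<Longrightarrow> a / 2 \<le> w 0 \<Longrightarrow> w 0 \<le> 2 * a \<Longrightarrow> 0 < r \<Longrightarrow> r \<le> R \<Longrightarrow>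
      b1 * r \<le> - spow p (v r) \<and> - spow p (v r) \<le> b2 * r"
    using slope_near_0[OF assms] by blast
  obtain C where C: "C \<ge> 0"
    "\<And>x y. \<bar>x\<bar> \<le> 2 * a \<Longrightarrow> \<bar>y\<bar> \<le> 2 * a \<Longrightarrow> \<bar>reaction x - reaction y\<bar> \<le> C * \<bar>x - y\<bar>"
    using reaction_Lipschitz[of "2 * a"] by blast
  define s where "s = 1 / (p - 1)"
  have "s > 0" using p_gt_1 by (simp add: s_def)
  have s_eq: "p / (p - 1) - 1 = s" using p_gt_1 by (simp add: s_def field_simps)
  define D where "D = s * (b1 powr (s - 1) + b2 powr (s - 1))"
  have "D \<ge> 0" using \<open>s > 0\<close> by (simp add: D_def)
  define E where "E = D * (C + 1)"
  have "E \<ge> 0" using \<open>D \<ge> 0\<close> C by (simp add: E_def)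
  \<comment> \<open>\<open>E * r0 \<le> 1 / 2\<close> allows the absorption of \<open>m / 2\<close>
    at the end; \<open>r0 \<le> 1\<close> gives \<open>x powr s \<le> 1\<close>.\<close>
  define r0 where "r0 = min R (min 1 (1 / (2 * (E + 1))))"
  have "r0 \<le> 1 / (2 * (E + 1))" by (simp add: r0_def)
  then have "E * r0 \<le> E * (1 / (2 * (E + 1)))" using \<open>E \<ge> 0\<close> by (rule mult_left_mono)
  also have "\<dots> \<le> 1 / 2" using \<open>E \<ge> 0\<close> by (simp add: field_simps)
  finally have "E * r0 \<le> 1 / 2" .
  moreover have "0 < r0" using R \<open>E \<ge> 0\<close> by (simp add: r0_def)
  moreover have "r0 \<le> R" "r0 \<le> 1" unfolding r0_def by linarith+
  ultimately have r0: "0 < r0" "r0 \<le> R" "r0 \<le> 1" "E * r0 \<le> 1 / 2" by auto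
  have "\<bar>w1 r - w2 r\<bar> \<le> 2 * \<bar>w1 0 - w2 0\<bar>"
    if sol: "sol w1 v1" "sol w2 v2" and w0: "a / 2 \<le> w1 0" "w1 0 \<le> 2 * a" "a / 2 \<le> w2 0" "w2 0 \<le> 2 * a"
      and r: "0 \<le> r" "r \<le> r0" for w1 v1 w2 v2 r
  proof -
    note cont = sol_contD[OF sol(1)] sol_contD[OF sol(2)]
    have "\<exists>t\<in>{0..r0}. \<forall>x\<in>{0..r0}. \<bar>w1 x - w2 x\<bar> \<le> \<bar>w1 t - w2 t\<bar>"
      using r0 by (intro continuous_attains_sup continuous_intros cont) auto
    then obtain t where t: "0 \<le> t" "t \<le> r0"
      "\<And>x. 0 \<le> x \<Longrightarrow> x \<le> r0 \<Longrightarrow> \<bar>w1 x - w2 x\<bar> \<le> \<bar>w1 t - w2 t\<bar>"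
      by auto
    \<comment> \<open>The maximal difference on \<open>{0..r0}\<close>; it will be bounded by the
      difference at 0 plus half of itself.\<close>
    define m where "m = \<bar>w1 t - w2 t\<bar>"
    have "m \<ge> 0" by (simp add: m_def)
    have v_diff: "\<bar>v1 x - v2 x\<bar> \<le> E * m" if x: "0 < x" "x \<le> r0" for x
    proof -
      have "x ^ n * \<bar>spow p (v1 x) - spow p (v2 x) + x * (w1 x - w2 x)\<bar> \<le> C * m * x ^ Suc n"
      proof (rule flux_diff_le[OF sol])
        show "((\<lambda>x. C * m * x ^ Suc n) has_real_derivative C * m * ((real n + 1) * y ^ n)) (at y)" for y
          by (auto intro!: derivative_eq_intros simp del: power_Suc simp: add.commute)
        show "y ^ n * \<bar>reaction (w1 y) - reaction (w2 y)\<bar> \<le> C * m * ((real n + 1) * y ^ n)"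
          if y: "0 < y" "y < x" for y
        proof -
          have "\<bar>reaction (w1 y) - reaction (w2 y)\<bar> \<le> C * \<bar>w1 y - w2 y\<bar>"
            using sol_bound[OF sol(1), of y] sol_bound[OF sol(2), of y] w0 y \<open>a > 0\<close> by (intro C) auto
          also have "\<dots> \<le> C * m"
            unfolding m_def using t(3)[of y] y x C by (intro mult_left_mono) auto
          also have "\<dots> \<le> C * m * (real n + 1)"
            using mult_left_mono[of 1 "real n + 1" "C * m"] C \<open>m \<ge> 0\<close> by simp
          finally have "y ^ n * \<bar>reaction (w1 y) - reaction (w2 y)\<bar> \<le> y ^ n * (C * m * (real n + 1))"
            using y by (intro mult_left_mono) auto
          then show ?thesis by (simp add: mult_ac)
        qed
      qed (use x in \<open>auto intro!: continuous_intros\<close>)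
      then have "x ^ n * \<bar>spow p (v1 x) - spow p (v2 x) + x * (w1 x - w2 x)\<bar> \<le> x ^ n * (C * m * x)"
        by (simp add: mult_ac)
      then have "\<bar>spow p (v1 x) - spow p (v2 x) + x * (w1 x - w2 x)\<bar> \<le> C * m * x"
        using x by (subst (asm) mult_le_cancel_left_pos) auto
      moreover have "\<bar>x * (w1 x - w2 x)\<bar> \<le> m * x"
        using t(3)[of x] x by (simp add: abs_mult m_def mult.commute)
      ultimately have u: "\<bar>spow p (v1 x) - spow p (v2 x)\<bar> \<le> (C + 1) * m * x"
        by (simp add: algebra_simps)
      have b: "b1 * x \<le> - spow p (v1 x)" "- spow p (v1 x) \<le> b2 * x"
        "b1 * x \<le> - spow p (v2 x)" "- spow p (v2 x) \<le> b2 * x"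
        using R(3)[OF sol(1) w0(1,2), of x] R(3)[OF sol(2) w0(3,4), of x] x r0 by auto
      have inv: "v = - ((- spow p v) powr s)" if "b1 * x \<le> - spow p v" for v
      proof -
        have "0 < b1 * x" using R x by simp
        then have "- spow p v > 0" using that by linarith
        then have "- v > 0" by simp
        have "- v = spow (p / (p - 1)) (- spow p v)"
          using spow_spow_conjugate[OF p_gt_1, of "- v"] by simp
        also have "\<dots> = \<bar>spow (p / (p - 1)) (- spow p v)\<bar>"
          by (rule spow_eq_abs_spow[OF less_imp_le]) fact
        also have "\<dots> = \<bar>- spow p v\<bar> powr (p / (p - 1) - 1)"
          using p_gt_1 by (intro abs_spow) simp
        also have "\<dots> = (- spow p v) powr s"
          unfolding abs_of_pos[OF \<open>- spow p v > 0\<close>] s_eq ..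
        finally show ?thesis by simp
      qed
      have "\<bar>v1 x - v2 x\<bar> = \<bar>(- spow p (v1 x)) powr s - (- spow p (v2 x)) powr s\<bar>"
        using inv[OF b(1)] inv[OF b(3)] by linarith
      also have "\<dots> \<le> D * x powr (s - 1) * \<bar>- spow p (v1 x) - - spow p (v2 x)\<bar>"
        unfolding D_def using R(2) \<open>s > 0\<close> x b by (intro powr_Lipschitz_scaled) auto
      also have "\<bar>- spow p (v1 x) - - spow p (v2 x)\<bar> = \<bar>spow p (v1 x) - spow p (v2 x)\<bar>" by simp
      also have "D * x powr (s - 1) * \<bar>spow p (v1 x) - spow p (v2 x)\<bar>
          \<le> D * x powr (s - 1) * ((C + 1) * m * x)"
        using u \<open>D \<ge> 0\<close> by (intro mult_left_mono) auto
      \<comment> \<open>The factor \<open>x\<close> from the flux difference compensates the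
        possibly singular \<open>x powr (s - 1)\<close>.\<close>
      also have "\<dots> = E * m * x powr s"
        using x by (simp add: E_def powr_diff)
      also have "\<dots> \<le> E * m * 1"
        using x r0 \<open>s > 0\<close> \<open>E \<ge> 0\<close> \<open>m \<ge> 0\<close> powr_mono2[of s x 1] by (intro mult_left_mono) auto
      finally show ?thesis by simp
    qed
    have "\<bar>(w1 t - w2 t) - (w1 0 - w2 0)\<bar> \<le> E * m * t - E * m * 0"
    proof (rule DERIV_abs_le_imp_abs_diff_le[OF t(1), where f' = "\<lambda>x. v1 x - v2 x" and g' = "\<lambda>_. E * m"])
      show "continuous_on {0..t} (\<lambda>x. w1 x - w2 x)"
        by (intro continuous_intros cont) auto
      show "((\<lambda>x. w1 x - w2 x) has_real_derivative v1 x - v2 x) (at x)" if "0 < x" for x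
        using that by (intro DERIV_diff sol_DERIV[OF sol(1)] sol_DERIV[OF sol(2)])
    qed (use v_diff t in \<open>auto intro!: continuous_intros derivative_eq_intros\<close>)
    also have "\<dots> \<le> m * (E * r0)"
      using t \<open>E \<ge> 0\<close> \<open>m \<ge> 0\<close> by (auto simp: mult.commute mult.left_commute intro!: mult_left_mono)
    also have "\<dots> \<le> m * (1 / 2)"
      using r0 \<open>m \<ge> 0\<close> by (intro mult_left_mono) auto
    finally have "\<bar>(w1 t - w2 t) - (w1 0 - w2 0)\<bar> \<le> m * (1 / 2)" .
    moreover have "m \<le> \<bar>(w1 t - w2 t) - (w1 0 - w2 0)\<bar> + \<bar>w1 0 - w2 0\<bar>"
      unfolding m_def by linarith
    ultimately have "m \<le> m * (1 / 2) + \<bar>w1 0 - w2 0\<bar>"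
      by (meson add_right_mono order.trans)
    then have "m \<le> 2 * \<bar>w1 0 - w2 0\<bar>" by simp
    then show ?thesis using t(3)[OF r] by (simp add: m_def)
  qed
  then show ?thesis using r0(1) by (intro that[of r0]) auto
qed

section \<open>Uniform continuous dependence on the half-line\<close>

lemma continuous_dependence_pos:
  assumes "a > 0" "R \<ge> 0" "\<epsilon> > 0"
  shows "\<exists>d>0. \<forall>w1 v1 w2 v2 r. sol w1 v1 \<longrightarrow> sol w2 v2 \<longrightarrow> w1 0 = a \<longrightarrow> \<bar>w2 0 - a\<bar> < d \<longrightarrow>
    0 \<le> r \<longrightarrow> r \<le> R \<longrightarrow> \<bar>w2 r - w1 r\<bar> < \<epsilon>"
proof -
  obtain r0 where r0: "r0 > 0"
    "\<And>w1 v1 w2 v2 r. sol w1 v1 \<Longrightarrow> sol w2 v2 \<Longrightarrow> a / 2 \<le> w1 0 \<Longrightarrow> w1 0 \<le> 2 * a \<Longrightarrow>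
      a / 2 \<le> w2 0 \<Longrightarrow> w2 0 \<le> 2 * a \<Longrightarrow> 0 \<le> r \<Longrightarrow> r \<le> r0 \<Longrightarrow>
      \<bar>w1 r - w2 r\<bar> \<le> 2 * \<bar>w1 0 - w2 0\<bar>"
    using dependence_near_0[OF \<open>a > 0\<close>] by blast
  obtain K where K: "K \<ge> 0"
    "\<And>w1 v1 w2 v2 m r. sol w1 v1 \<Longrightarrow> sol w2 v2 \<Longrightarrow> \<bar>w1 0\<bar> \<le> 2 * a \<Longrightarrow> \<bar>w2 0\<bar> \<le> 2 * a \<Longrightarrow> m \<ge> 0 \<Longrightarrow>
      (\<And>x. 0 \<le> x \<Longrightarrow> x \<le> r0 \<Longrightarrow> \<bar>w1 x - w2 x\<bar> \<le> m) \<Longrightarrow> 0 \<le> r \<Longrightarrow> r \<le> R \<Longrightarrow>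
      \<bar>w1 r - w2 r\<bar> \<le> K * m"
    using dependence_away_from_0[OF r0(1) \<open>R \<ge> 0\<close>, of "2 * a"] by metis
  \<comment> \<open>\<open>a / 2\<close> keeps \<open>w2 0\<close> in the range of
    \<open>dependence_near_0\<close>; the second entry makes
    \<open>2 * K * d < \<epsilon>\<close>.\<close>
  define d where "d = min (a / 2) (\<epsilon> / (2 * K + 1))"
  have "d > 0" using assms K by (simp add: d_def)
  moreover have "\<bar>w2 r - w1 r\<bar> < \<epsilon>"
    if sol: "sol w1 v1" "sol w2 v2" and "w1 0 = a" "\<bar>w2 0 - a\<bar> < d" "0 \<le> r" "r \<le> R" for w1 v1 w2 v2 r
  proof -
    have "\<bar>w2 0 - a\<bar> < a / 2" using that by (simp add: d_def)
    then have w2: "a / 2 \<le> w2 0" "w2 0 \<le> 2 * a" using \<open>a > 0\<close> by linarith+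
    have "\<bar>w2 r - w1 r\<bar> \<le> K * (2 * \<bar>w2 0 - w1 0\<bar>)"
      using w2 \<open>a > 0\<close> that r0(2)[OF sol(2,1)]
      by (intro K(2)[OF sol(2,1)]) auto
    also have "\<dots> \<le> K * (2 * (\<epsilon> / (2 * K + 1)))"
      using that K by (intro mult_left_mono) (auto simp: d_def)
    also have "\<dots> < \<epsilon>" using K \<open>\<epsilon> > 0\<close> by (simp add: field_simps)
    finally show ?thesis .
  qed
  ultimately show ?thesis by blast
qed

text \<open>Negative \<open>a\<close> follows by oddness. At \<open>a = 0\<close> the near-origin
  analysis has no positive slope to work with, but there \<open>sol_bound\<close> makes
  \<open>w1\<close> vanish and \<open>w2\<close> small.\<close>

lemma continuous_dependence:
  assumes "R \<ge> 0" "\<epsilon> > 0"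
  shows "\<exists>d>0. \<forall>w1 v1 w2 v2 r. sol w1 v1 \<longrightarrow> sol w2 v2 \<longrightarrow> w1 0 = a \<longrightarrow> \<bar>w2 0 - a\<bar> < d \<longrightarrow>
    0 \<le> r \<longrightarrow> r \<le> R \<longrightarrow> \<bar>w2 r - w1 r\<bar> < \<epsilon>"
proof -
  consider "a > 0" | "a = 0" | "a < 0" by linarith
  then show ?thesis
  proof cases
    case 1
    then show ?thesis using continuous_dependence_pos assms by blast
  next
    case 2
    have "\<bar>w2 r - w1 r\<bar> < \<epsilon>"
      if "sol w1 v1" "sol w2 v2" "w1 0 = a" "\<bar>w2 0 - a\<bar> < \<epsilon>" "0 \<le> r" "r \<le> R" for w1 v1 w2 v2 r
      using sol_bound[OF that(1,5)] sol_bound[OF that(2,5)] that 2 by simp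
    then show ?thesis using \<open>\<epsilon> > 0\<close> by blast
  next
    case 3
    then obtain d where d: "d > 0"
      "\<And>w1 v1 w2 v2 r. sol w1 v1 \<Longrightarrow> sol w2 v2 \<Longrightarrow> w1 0 = - a \<Longrightarrow> \<bar>w2 0 - (- a)\<bar> < d \<Longrightarrow>
        0 \<le> r \<Longrightarrow> r \<le> R \<Longrightarrow> \<bar>w2 r - w1 r\<bar> < \<epsilon>"
      using continuous_dependence_pos[of "- a"] assms by (metis neg_0_less_iff_less)
    have "\<bar>w2 r - w1 r\<bar> < \<epsilon>"
      if "sol w1 v1" "sol w2 v2" "w1 0 = a" "\<bar>w2 0 - a\<bar> < d" "0 \<le> r" "r \<le> R" for w1 v1 w2 v2 r
      using d(2)[OF sol_minus[OF that(1)] sol_minus[OF that(2)], of r] that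
      by (simp add: abs_minus_commute)
    then show ?thesis using d(1) by blast
  qed
qed

lemma uniform_dependence:
  assumes "\<epsilon> > 0"
  shows "\<exists>d>0. \<forall>w1 v1 w2 v2. sol w1 v1 \<longrightarrow> sol w2 v2 \<longrightarrow> w1 0 = a \<longrightarrow> \<bar>w2 0 - a\<bar> < d \<longrightarrow>
    \<bar>Lim at_top (\<lambda>r. r powr \<alpha> * w2 r) - Lim at_top (\<lambda>r. r powr \<alpha> * w1 r)\<bar> < \<epsilon> \<and>
    (\<forall>r\<ge>0. (1 + r) powr \<alpha> * \<bar>w2 r - w1 r\<bar> < \<epsilon>)"
proof -
  obtain C \<eta> where C: "C \<ge> 0" "\<eta> > 0"
    "\<And>w v r. sol w v \<Longrightarrow> \<bar>w 0\<bar> \<le> \<bar>a\<bar> + 1 \<Longrightarrow> 1 \<le> r \<Longrightarrow>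
       \<bar>r powr \<alpha> * w r - Lim at_top (\<lambda>r. r powr \<alpha> * w r)\<bar> \<le> C * r powr - \<eta>"
    by (rule uniform_limit_at_top[of "\<bar>a\<bar> + 1"]) (rule that)
  \<comment> \<open>At \<open>R\<close> the limits differ by less than \<open>3 * e\<close>: two
    tails and one near estimate. Beyond \<open>R\<close> two more tails give \<open>5 * e\<close>,
    and \<open>1 + r \<le> 2 * r\<close> costs the factor \<open>2 powr \<alpha>\<close>.\<close>
  define e where "e = \<epsilon> / (8 * 2 powr \<alpha>)"
  have "2 powr \<alpha> \<ge> 1" using alpha_pos by (intro ge_one_powr_ge_zero) auto
  then have "e \<le> \<epsilon> / (8 * 1)" unfolding e_def using \<open>\<epsilon> > 0\<close>
    by (intro divide_left_mono mult_left_mono) auto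
  then have e: "e > 0" "5 * e < \<epsilon>" "2 powr \<alpha> * (5 * e) < \<epsilon>"
    using \<open>\<epsilon> > 0\<close> by (auto simp: e_def)
  have "((\<lambda>r::real. C * r powr - \<eta>) \<longlongrightarrow> C * 0) at_top"
    using C(2) by (intro tendsto_intros tendsto_neg_powr filterlim_ident) auto
  then have "\<forall>\<^sub>F r::real in at_top. C * r powr - \<eta> < e"
    using e by (intro order_tendstoD(2)) auto
  then have "\<forall>\<^sub>F r::real in at_top. C * r powr - \<eta> < e \<and> r \<ge> 1"
    using eventually_ge_at_top by (rule eventually_conj)
  then obtain R where R: "\<And>r. r \<ge> R \<Longrightarrow> C * r powr - \<eta> < e \<and> r \<ge> 1"
    unfolding eventually_at_top_linorder by blast
  then have "R \<ge> 1" by blast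
  obtain d where d: "d > 0"
    "\<And>w1 v1 w2 v2 r. sol w1 v1 \<Longrightarrow> sol w2 v2 \<Longrightarrow> w1 0 = a \<Longrightarrow> \<bar>w2 0 - a\<bar> < d \<Longrightarrow>
      0 \<le> r \<Longrightarrow> r \<le> R \<Longrightarrow> \<bar>w2 r - w1 r\<bar> < e / (1 + R) powr \<alpha>"
    using continuous_dependence[of R "e / (1 + R) powr \<alpha>" a] \<open>R \<ge> 1\<close> e(1) by auto
  have "\<bar>Lim at_top (\<lambda>r. r powr \<alpha> * w2 r) - Lim at_top (\<lambda>r. r powr \<alpha> * w1 r)\<bar> < \<epsilon> \<and>
    (\<forall>r\<ge>0. (1 + r) powr \<alpha> * \<bar>w2 r - w1 r\<bar> < \<epsilon>)"
    if sol: "sol w1 v1" "sol w2 v2" and w1: "w1 0 = a" and w2: "\<bar>w2 0 - a\<bar> < min d 1" for w1 v1 w2 v2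
  proof -
    define l1 l2 where "l1 = Lim at_top (\<lambda>r. r powr \<alpha> * w1 r)" and "l2 = Lim at_top (\<lambda>r. r powr \<alpha> * w2 r)"
    have A: "\<bar>w1 0\<bar> \<le> \<bar>a\<bar> + 1" "\<bar>w2 0\<bar> \<le> \<bar>a\<bar> + 1" using w1 w2 by auto
    have lim: "\<bar>r powr \<alpha> * w1 r - l1\<bar> < e" "\<bar>r powr \<alpha> * w2 r - l2\<bar> < e" if "r \<ge> R" for r
      using C(3)[OF sol(1) A(1), of r] C(3)[OF sol(2) A(2), of r] R[OF that]
      by (auto simp: l1_def l2_def)
    have near: "(1 + r) powr \<alpha> * \<bar>w2 r - w1 r\<bar> < e" if "0 \<le> r" "r \<le> R" for r
    proof -
      have "(1 + r) powr \<alpha> * \<bar>w2 r - w1 r\<bar> \<le> (1 + R) powr \<alpha> * \<bar>w2 r - w1 r\<bar>"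
        using that alpha_pos by (intro mult_right_mono powr_mono2) auto
      also have "\<dots> < (1 + R) powr \<alpha> * (e / (1 + R) powr \<alpha>)"
        using d(2)[OF sol w1 _ that] w2 \<open>R \<ge> 1\<close> by (intro mult_strict_left_mono) auto
      finally show ?thesis using \<open>R \<ge> 1\<close> by simp
    qed
    have "\<bar>R powr \<alpha> * w2 R - R powr \<alpha> * w1 R\<bar> = R powr \<alpha> * \<bar>w2 R - w1 R\<bar>"
      by (simp add: abs_mult flip: right_diff_distrib)
    also have "\<dots> \<le> (1 + R) powr \<alpha> * \<bar>w2 R - w1 R\<bar>"
      using \<open>R \<ge> 1\<close> alpha_pos by (intro mult_right_mono powr_mono2) auto
    finally have l: "\<bar>l2 - l1\<bar> < 3 * e"
      using near[of R] lim[of R] \<open>R \<ge> 1\<close> by linarith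
    have "(1 + r) powr \<alpha> * \<bar>w2 r - w1 r\<bar> < \<epsilon>" if "r \<ge> 0" for r
    proof (cases "r \<le> R")
      case True
      then show ?thesis using near[of r] that e by simp
    next
      case False
      then have "(1 + r) powr \<alpha> * \<bar>w2 r - w1 r\<bar> \<le> (2 * r) powr \<alpha> * \<bar>w2 r - w1 r\<bar>"
        using \<open>R \<ge> 1\<close> alpha_pos by (intro mult_right_mono powr_mono2) auto
      also have "\<dots> = 2 powr \<alpha> * \<bar>r powr \<alpha> * w2 r - r powr \<alpha> * w1 r\<bar>"
        using that by (simp add: powr_mult abs_mult flip: right_diff_distrib)
      also have "\<dots> \<le> 2 powr \<alpha> * (5 * e)"
        using lim[of r] l False by (intro mult_left_mono) auto
      finally show ?thesis using e by simp
    qed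
    then show ?thesis using l e by (auto simp: l1_def l2_def)
  qed
  then show ?thesis using d(1) by (intro exI[of _ "min d 1"]) auto
qed

section \<open>Transfer to the initial value problem\<close>

lemma ivp_solution_imp_sol:
  assumes "ivp_solution (Suc n) p q \<alpha> a w"
  shows "w 0 = a" "\<exists>v. sol w v"
proof -
  obtain v u' where w: "C1_half_line w v" and u: "C1_half_line (\<lambda>r. spow p (v r)) u'"
    and eq: "\<And>r. r > 0 \<Longrightarrow> u' r + n / r * spow p (v r) + r * v r + \<alpha> * w r + \<bar>w r\<bar> powr (q - 1) * w r = 0"
    and "w 0 = a" "v 0 = 0"
    using assms unfolding ivp_solution_def by auto
  then show "w 0 = a" by simp
  \<comment> \<open>The one-sided derivatives of \<open>C1_half_line\<close> are two-sided at
    interior points.\<close>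
  have at: "at r within {0..} = at r" if "r > 0" for r :: real
    using that by (intro at_within_interior) (simp add: interior_real_atLeast)
  have "continuous_on {0..} w" "continuous_on {0..} v"
    using w by (auto simp: C1_half_line_def intro: DERIV_continuous_on)
  moreover have "u' r = - (n / r * spow p (v r)) - r * v r - \<alpha> * w r - spow (q + 1) (w r)" if "r > 0" for r
    using eq[OF that] by (simp add: spow_def)
  then have "((\<lambda>r. spow p (v r)) has_real_derivative
      - (n / r * spow p (v r)) - r * v r - \<alpha> * w r - spow (q + 1) (w r)) (at r)"
    if "r > 0" for r
    using u at[OF that] that unfolding C1_half_line_def by (metis less_imp_le)
  moreover have "(w has_real_derivative v r) (at r)" if "r > 0" for r
    using w at[OF that] that unfolding C1_half_line_def by (metis less_imp_le)
  ultimately show "\<exists>v. sol w v" using \<open>v 0 = 0\<close> unfolding sol_def by blast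
qed

end

theorem theorem3p5:
  fixes N :: nat and p q \<alpha> :: real
    and w :: "real \<Rightarrow> real \<Rightarrow> real" and L :: "real \<Rightarrow> real"
  assumes "N \<ge> 1" and "p > 1" and "q > 1" and "\<alpha> > 0"
    and "p > 2 \<or> (p < 2 \<and> \<alpha> < p / (2 - p))"
    and "\<And>a. ivp_solution N p q \<alpha> a (\<lambda>r. w r a)"
    and "\<And>a. L a = Lim at_top (\<lambda>r. r powr \<alpha> * w r a)"
  shows "continuous_on UNIV L \<and>
         equicontinuous_on UNIV {0..} (\<lambda>r a. (1 + r) powr \<alpha> * w r a)"
proof -
  obtain n where N: "N = Suc n" using assms(1) by (cases N) auto
  have "\<alpha> * (2 - p) < p"
  proof (cases "p > 2")
    case True
    then have "\<alpha> * (2 - p) \<le> 0" using assms(4) by (intro mult_nonneg_nonpos) auto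
    then show ?thesis using assms(2) by simp
  next
    case False
    then show ?thesis using assms(5) by (auto simp: pos_less_divide_eq)
  qed
  then interpret self_similar n p q \<alpha>
    using assms(2-4) by unfold_locales
  have w0: "w 0 a = a" for a
    using ivp_solution_imp_sol(1) assms(6)[of a] N by blast
  have "\<exists>v. sol (\<lambda>r. w r a) v" for a
    using ivp_solution_imp_sol(2) assms(6)[of a] N by blast
  then obtain v where v: "\<And>a. sol (\<lambda>r. w r a) (v a)" by metis
  \<comment> \<open>One \<open>d\<close>, independent of \<open>r\<close>, serves both the
    continuity of \<open>L\<close> and the equicontinuity.\<close>
  have main: "\<exists>d>0. \<forall>b. \<bar>b - a\<bar> < d \<longrightarrow> \<bar>L b - L a\<bar> < \<epsilon> \<and>
      (\<forall>r\<ge>0. (1 + r) powr \<alpha> * \<bar>w r b - w r a\<bar> < \<epsilon>)" if eps: "\<epsilon> > 0" for a \<epsilon>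
  proof -
    obtain d where d: "d > 0" "\<And>w1 v1 w2 v2. sol w1 v1 \<Longrightarrow> sol w2 v2 \<Longrightarrow> w1 0 = a \<Longrightarrow> \<bar>w2 0 - a\<bar> < d \<Longrightarrow>
      \<bar>Lim at_top (\<lambda>r. r powr \<alpha> * w2 r) - Lim at_top (\<lambda>r. r powr \<alpha> * w1 r)\<bar> < \<epsilon> \<and>
      (\<forall>r\<ge>0. (1 + r) powr \<alpha> * \<bar>w2 r - w1 r\<bar> < \<epsilon>)"
      using uniform_dependence[OF eps, of a] by blast
    show ?thesis
      using d(1) d(2)[OF v v, of a] by (intro exI[of _ d]) (auto simp: w0 assms(7))
  qed
  have "continuous_on UNIV L"
    unfolding continuous_on_iff dist_real_def using main by (metis UNIV_I)
  moreover have eq: "dist ((1 + r) powr \<alpha> * w r b) ((1 + r) powr \<alpha> * w r a) = (1 + r) powr \<alpha> * \<bar>w r b - w r a\<bar>"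
    for r a b
    by (simp add: dist_real_def abs_mult flip: right_diff_distrib)
  have "equicontinuous_on UNIV {0..} (\<lambda>r a. (1 + r) powr \<alpha> * w r a)"
    unfolding equicontinuous_on_def eq
  proof (intro ballI allI impI)
    fix a \<epsilon> :: real
    assume "\<epsilon> > 0"
    then obtain d where "d > 0"
      "\<And>b r. \<bar>b - a\<bar> < d \<Longrightarrow> r \<ge> 0 \<Longrightarrow> (1 + r) powr \<alpha> * \<bar>w r b - w r a\<bar> < \<epsilon>"
      using main[of \<epsilon> a] by blast
    then show "\<exists>\<delta>>0. \<forall>b\<in>UNIV. dist b a < \<delta> \<longrightarrow>
        (\<forall>r\<in>{0..}. (1 + r) powr \<alpha> * \<bar>w r b - w r a\<bar> < \<epsilon>)"
      by (intro exI[of _ d]) (auto simp: dist_real_def)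
  qed
  ultimately show ?thesis by blast
qed

end
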